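(* The group $A(\Gamma)$ has $R_\infty$-nilpotency index $2$ for almost all unlabelled graphs $\Gamma$. That is, if $G_n$ denotes the number of isomorphism classes of graphs on $n$ vertices and $G_n'$ denotes the number of isomorphism classes of graphs $\Gamma$ on $n$ vertices for which $A(\Gamma)$ has $R_\infty$-nilpotency index equal to $2$, then $\lim_{n\to\infty} G_n'/G_n=1$.
   Context: A graph $\Gamma=(V,E)$ consists of a finite set $V$ and a set $E\subseteq\{\{v,w\}\mid v,w\in V, v\neq w\}$. The right-angled Artin group is defined with the convention that NON-adjacent vertices commute: $A(\Gamma)=\langle V\mid [v,w];\ v,w\in V,\ \{v,w\}\notin E\rangle$. For a group $G$ and $\varphi\in\mathrm{Aut}(G)$, elements $x,y\in G$ are $\varphi$-conjugate if $x=zy\varphi(z)^{-1}$ for some $z\in G$; the Reidemeister number $R(\varphi)\in\{1,2,3,\dots\}\cup\{\infty\}$ is the number of $\varphi$-conjugacy classes. $G$ has the $R_\infty$-property if $R(\varphi)=\infty$ for every $\varphi\in\mathrm{Aut}(G)$. The lower central series is $\gamma_1(G)=G$, $\gamma_{i+1}(G)=[G,\gamma_i(G)]$. The $R_\infty$-nilpotency index of $G$ is the least integer $c$ such that $G/\gamma_{c+1}(G)$ has the $R_\infty$-property (infinite if no such integer exists). *)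

theory Defs
  imports Complex_Main "HOL-Library.Extended_Nat" "HOL-Algebra.Generated_Groups"
begin

section \<open>Graphs\<close>

type_synonym 'a graph = "'a set \<times> 'a set set"

definition is_graph :: "'a graph \<Rightarrow> bool" where
  "is_graph \<Gamma> \<longleftrightarrow>
     finite (fst \<Gamma>) \<and> snd \<Gamma> \<subseteq> {{v, w} |v w. v \<in> fst \<Gamma> \<and> w \<in> fst \<Gamma> \<and> v \<noteq> w}"

definition graph_isomorphic :: "'a graph \<Rightarrow> 'b graph \<Rightarrow> bool" where
  "graph_isomorphic \<Gamma> \<Delta> \<longleftrightarrow>
     (\<exists>f. bij_betw f (fst \<Gamma>) (fst \<Delta>) \<and> (\<lambda>e. f ` e) ` snd \<Gamma> = snd \<Delta>)"

text \<open>
  Every finite graph with \<open>n\<close> vertices is isomorphic to one with vertex set \<open>{..<n}\<close>, so the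
  isomorphism classes of graphs on \<open>n\<close> vertices (the unlabelled graphs) are taken to be the
  classes of graphs with this vertex set.
\<close>

definition graphs_on :: "nat \<Rightarrow> nat graph set" where
  "graphs_on n = {\<Gamma>. is_graph \<Gamma> \<and> fst \<Gamma> = {..<n}}"

definition unlabelled_graphs :: "nat \<Rightarrow> nat graph set set" where
  "unlabelled_graphs n =
     graphs_on n // {(\<Gamma>, \<Delta>). \<Gamma> \<in> graphs_on n \<and> \<Delta> \<in> graphs_on n \<and> graph_isomorphic \<Gamma> \<Delta>}"


section \<open>Group presentations and right-angled Artin groups\<close>

text \<open>
  A letter \<open>(x, True)\<close> stands for the generator \<open>x\<close> and \<open>(x, False)\<close> for its formal inverse.
\<close>

type_synonym 'a word = "('a \<times> bool) list"

definition words :: "'a set \<Rightarrow> 'a word set" where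
  "words X = lists (X \<times> UNIV)"

text \<open>
  The congruence on words generated by free cancellation and by \<open>r = 1\<close> for every relator \<open>r\<close>.
\<close>

inductive pres_eq :: "'a set \<Rightarrow> 'a word set \<Rightarrow> 'a word \<Rightarrow> 'a word \<Rightarrow> bool"
  for X :: "'a set" and R :: "'a word set" where
  refl: "u \<in> words X \<Longrightarrow> pres_eq X R u u"
| sym: "pres_eq X R u v \<Longrightarrow> pres_eq X R v u"
| trans: "pres_eq X R u v \<Longrightarrow> pres_eq X R v w \<Longrightarrow> pres_eq X R u w"
| cancel: "u \<in> words X \<Longrightarrow> v \<in> words X \<Longrightarrow> x \<in> X \<Longrightarrow>
    pres_eq X R (u @ [(x, b), (x, \<not> b)] @ v) (u @ v)"
| relator: "u \<in> words X \<Longrightarrow> v \<in> words X \<Longrightarrow> r \<in> R \<Longrightarrow> r \<in> words X \<Longrightarrow>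
    pres_eq X R (u @ r @ v) (u @ v)"

definition pres_rel :: "'a set \<Rightarrow> 'a word set \<Rightarrow> ('a word \<times> 'a word) set" where
  "pres_rel X R = {(u, v). pres_eq X R u v}"

definition presented_group :: "'a set \<Rightarrow> 'a word set \<Rightarrow> 'a word set monoid" where
  "presented_group X R =
     \<lparr>carrier = words X // pres_rel X R,
      mult = (\<lambda>A B. \<Union>a\<in>A. \<Union>b\<in>B. pres_rel X R `` {a @ b}),
      one = pres_rel X R `` {[]}\<rparr>"

definition commutator_word :: "'a \<Rightarrow> 'a \<Rightarrow> 'a word" where
  "commutator_word v w = [(v, True), (w, True), (v, False), (w, False)]"

text \<open>Convention: \<^emph>\<open>non\<close>-adjacent vertices commute.\<close>

definition raag :: "'a graph \<Rightarrow> 'a word set monoid" where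
  "raag \<Gamma> = presented_group (fst \<Gamma>)
     {commutator_word v w |v w. v \<in> fst \<Gamma> \<and> w \<in> fst \<Gamma> \<and> {v, w} \<notin> snd \<Gamma>}"


section \<open>Twisted conjugacy and the \<open>R\<^sub>\<infinity>\<close>-nilpotency index\<close>

definition twisted_conj_rel :: "('a, 'b) monoid_scheme \<Rightarrow> ('a \<Rightarrow> 'a) \<Rightarrow> ('a \<times> 'a) set" where
  "twisted_conj_rel G \<phi> =
     {(x, y). x \<in> carrier G \<and> y \<in> carrier G \<and>
        (\<exists>z\<in>carrier G. x = z \<otimes>\<^bsub>G\<^esub> y \<otimes>\<^bsub>G\<^esub> inv\<^bsub>G\<^esub> (\<phi> z))}"

definition reidemeister_number :: "('a, 'b) monoid_scheme \<Rightarrow> ('a \<Rightarrow> 'a) \<Rightarrow> enat" where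
  "reidemeister_number G \<phi> =
     (let C = carrier G // twisted_conj_rel G \<phi> in if finite C then enat (card C) else \<infinity>)"

definition R_infinity_property :: "('a, 'b) monoid_scheme \<Rightarrow> bool" where
  "R_infinity_property G \<longleftrightarrow> (\<forall>\<phi>\<in>iso G G. reidemeister_number G \<phi> = \<infinity>)"

definition commutator_subgroup ::
    "('a, 'b) monoid_scheme \<Rightarrow> 'a set \<Rightarrow> 'a set \<Rightarrow> 'a set" where
  "commutator_subgroup G H K =
     generate G (\<Union>h\<in>H. \<Union>k\<in>K. {h \<otimes>\<^bsub>G\<^esub> k \<otimes>\<^bsub>G\<^esub> inv\<^bsub>G\<^esub> h \<otimes>\<^bsub>G\<^esub> inv\<^bsub>G\<^esub> k})"

text \<open>The series is indexed from \<open>1\<close>; the value at \<open>0\<close> is a dummy.\<close>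

fun lower_central :: "('a, 'b) monoid_scheme \<Rightarrow> nat \<Rightarrow> 'a set" where
  "lower_central G 0 = carrier G"
| "lower_central G (Suc 0) = carrier G"
| "lower_central G (Suc (Suc i)) =
     commutator_subgroup G (carrier G) (lower_central G (Suc i))"

text \<open>The infimum of the empty set in \<^typ>\<open>enat\<close> is \<open>\<infinity>\<close>.\<close>

definition R_infinity_nilpotency_index :: "('a, 'b) monoid_scheme \<Rightarrow> enat" where
  "R_infinity_nilpotency_index G =
     Inf {enat c |c. R_infinity_property (G Mod lower_central G (c + 1))}"

end

theory Submission
  imports Defs "HOL-Combinatorics.Permutations" "HOL-Real_Asymp.Real_Asymp"
begin

text \<open>
  An automorphism \<open>\<phi>\<close> of \<open>A(\<Gamma>)/\<gamma>\<^sub>3\<close> induces an integer matrix \<open>A\<close> on the abelianization that respects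
  the relation of commuting. If no vertex dominates another one, comparing the ranks of centralizers
  shows that \<open>A\<close> is a signed permutation matrix and that the permutation is an automorphism of \<open>\<Gamma>\<close>.
  If moreover \<open>\<Gamma>\<close> is asymmetric, \<open>A\<close> is diagonal with entries \<open>\<plusminus>1\<close>. An entry \<open>1\<close> at \<open>v\<close> separates the
  twisted classes of the powers of \<open>v\<close>; if \<open>A = -1\<close>, then \<open>\<phi>\<close> is the identity on \<open>\<gamma>\<^sub>2/\<gamma>\<^sub>3\<close> and the
  powers of \<open>[a, b]\<close>, for an edge \<open>{a, b}\<close>, are pairwise not twisted conjugate. On the quotients by
  \<open>\<gamma>\<^sub>1\<close> and \<open>\<gamma>\<^sub>2\<close>, inversion has finite Reidemeister number.

  A random graph on \<open>n\<close> vertices has a dominated vertex with probability at most \<open>n^2 * (3/4)^(n - 2)\<close>. A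
  permutation moving \<open>k\<close> points fixes at most a proportion \<open>2 powr (- k * (n - 2) / 6)\<close> of all labelled
  graphs, so the nontrivial permutations contribute a vanishing proportion both to the non-asymmetric graphs and to
  the orbit count, which makes the passage from labelled to unlabelled graphs harmless.
\<close>

section \<open>Integer matrices preserving the commutation relation\<close>

text \<open>Domination must be excluded: if every other \<open>z\<close> commuting with
  \<open>u\<close> also commutes with \<open>w\<close>, then sending \<open>u\<close> to
  \<open>u * w\<close> and fixing the remaining generators defines an automorphism whose matrix is
  not monomial. The rank comparison is a count of linear equations: the rows of \<open>A\<close> at
  the vertices commuting with \<open>v\<close> are independent, and their vanishing minors with row
  \<open>v\<close> make every combination of them determined by its values on few vertices. Equality
  of ranks follows because the count applies to \<open>A\<close> and to its inverse. A presentation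
  supplies relations but does not show that anything survives them; the group
  \<open>heisenberg E\<close> is a model in which exponent sums and the infinite order of
  \<open>[a, b]\<close> can be read off. In the exponent \<open>- k * (n - 2) / 6\<close>, a moved
  vertex yields \<open>n - 2\<close> moved pairs, each obtained at most twice, and at least a third
  of the moved pairs are determined by the rest of an invariant edge set, whence 6 = 2 * 3. This
  decay beats the at most \<open>n ^ k\<close> permutations moving \<open>k\<close> points. Orbit
  counting uses two inequalities only: half of Burnside's lemma, and the bound \<open>n!\<close> on
  the size of an orbit.\<close>

lemma homogeneous_system_solution:
  fixes c :: "'d \<Rightarrow> 'k \<Rightarrow> int"
  assumes "finite D" "finite K" "card D < card K"
  shows "\<exists>y. (\<exists>k\<in>K. y k \<noteq> 0) \<and> (\<forall>d\<in>D. (\<Sum>k\<in>K. y k * c d k) = 0)"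
  using assms
proof (induction D arbitrary: K c rule: finite_induct)
  case empty
  then have "K \<noteq> {}" by auto
  then show ?case by (intro exI[of _ "\<lambda>_. 1"]) auto
next
  case (insert d D)
  show ?case
  proof (cases "\<forall>k\<in>K. c d k = 0")
    case True
    have "card D < card K" using insert by auto
    then obtain y where "\<exists>k\<in>K. y k \<noteq> 0" "\<forall>e\<in>D. (\<Sum>k\<in>K. y k * c e k) = 0"
      using insert.IH insert.prems by blast
    then show ?thesis using True by (intro exI[of _ y]) auto
  next
    case False
    then obtain k0 where k0: "k0 \<in> K" "c d k0 \<noteq> 0" by auto
    define K' where "K' = K - {k0}"
    have K': "finite K'" "card D < card K'" "k0 \<notin> K'" "K = insert k0 K'"
      using insert k0 by (auto simp: K'_def)
    obtain y where y: "\<exists>k\<in>K'. y k \<noteq> 0"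
      "\<And>e. e \<in> D \<Longrightarrow> (\<Sum>k\<in>K'. y k * (c e k * c d k0 - c e k0 * c d k)) = 0"
      using insert.IH[OF K'(1,2), of "\<lambda>e k. c e k * c d k0 - c e k0 * c d k"] by blast
    \<comment> \<open>Fraction-free elimination: scaling the other unknowns by the pivot
      \<open>c d k0\<close> lets equation \<open>d\<close> be solved for \<open>k0\<close> over the
      integers.\<close>
    define x where "x = (\<lambda>k. if k = k0 then - (\<Sum>k\<in>K'. y k * c d k) else y k * c d k0)"
    have x: "(\<Sum>k\<in>K. x k * c e k) = (\<Sum>k\<in>K'. y k * (c e k * c d k0 - c e k0 * c d k))" for e
    proof -
      have "(\<Sum>k\<in>K. x k * c e k) = x k0 * c e k0 + (\<Sum>k\<in>K'. x k * c e k)"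
        using K' by simp
      also have "(\<Sum>k\<in>K'. x k * c e k) = (\<Sum>k\<in>K'. y k * c d k0 * c e k)"
        using K' by (intro sum.cong) (auto simp: x_def)
      also have "x k0 = - (\<Sum>k\<in>K'. y k * c d k)" by (simp add: x_def)
      finally show ?thesis
        by (simp add: sum_distrib_left sum_subtractf sum_negf algebra_simps)
    qed
    show ?thesis
    proof (intro exI[of _ x] conjI ballI)
      show "\<exists>k\<in>K. x k \<noteq> 0" using y(1) k0 K' by (auto simp: x_def)
      show "(\<Sum>k\<in>K. x k * c e k) = 0" if "e \<in> insert d D" for e
        using that y(2) by (cases "e = d") (auto simp: x)
    qed
  qed
qed

definition inverse_matrices :: "'a set \<Rightarrow> ('a \<Rightarrow> 'a \<Rightarrow> int) \<Rightarrow> ('a \<Rightarrow> 'a \<Rightarrow> int) \<Rightarrow> bool" where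
  "inverse_matrices V A B \<longleftrightarrow>
     (\<forall>v\<in>V. \<forall>w\<in>V. (\<Sum>u\<in>V. A v u * B u w) = (if v = w then 1 else 0)) \<and>
     (\<forall>v\<in>V. \<forall>w\<in>V. (\<Sum>u\<in>V. B v u * A u w) = (if v = w then 1 else 0))"

text \<open>The 2 x 2 minors at edges are the coordinates of the commutator of two elements in
  \<open>\<gamma>\<^sub>2/\<gamma>\<^sub>3\<close>, so they vanish on the images of commuting
  generators.\<close>

definition commutation_preserving :: "'a set \<Rightarrow> 'a set set \<Rightarrow> ('a \<Rightarrow> 'a \<Rightarrow> int) \<Rightarrow> bool" where
  "commutation_preserving V E A \<longleftrightarrow>
     (\<forall>v\<in>V. \<forall>w\<in>V. {v, w} \<notin> E \<longrightarrow>
        (\<forall>p\<in>V. \<forall>q\<in>V. {p, q} \<in> E \<longrightarrow> A v p * A w q = A v q * A w p))"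

definition undominated :: "'a set \<Rightarrow> 'a set set \<Rightarrow> bool" where
  "undominated V E \<longleftrightarrow>
     (\<forall>u\<in>V. \<forall>w\<in>V. u \<noteq> w \<longrightarrow> (\<exists>z\<in>V - {u, w}. {z, u} \<notin> E \<and> {z, w} \<in> E))"

text \<open>Without loops the set contains \<open>v\<close> itself: it lists all generators that
  commute with \<open>v\<close>.\<close>

definition nonneighbours :: "'a set \<Rightarrow> 'a set set \<Rightarrow> 'a \<Rightarrow> 'a set" where
  "nonneighbours V E v = {w \<in> V. {v, w} \<notin> E}"

lemma inverse_matrices_sym: "inverse_matrices V A B \<Longrightarrow> inverse_matrices V B A"
  by (auto simp: inverse_matrices_def)

text \<open>Zeros spread along edges: for a combination \<open>Y\<close> of rows commuting with row
  \<open>v\<close>, the minor equation \<open>A v t * Y q = A v q * Y t\<close> carries a zero of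
  \<open>Y\<close> at a support vertex \<open>t\<close> to its neighbours \<open>q\<close>. So
  \<open>Y\<close> vanishes everywhere once it vanishes on the set on the right. With more rows than
  places, some nontrivial \<open>Y\<close> would vanish, against invertibility.\<close>

lemma nonneighbours_le_determining_set:
  fixes A B :: "'a \<Rightarrow> 'a \<Rightarrow> int"
  assumes fin: "finite V" and inv: "inverse_matrices V A B"
    and comm: "commutation_preserving V E A"
    and v: "v \<in> V" and S: "S = {u \<in> V. A v u \<noteq> 0}"
    and T: "T \<subseteq> S" "\<And>q. q \<in> S - T \<Longrightarrow> \<exists>t\<in>T. {t, q} \<in> E"
  shows "card (nonneighbours V E v) \<le> card (T \<union> {z \<in> V - S. \<forall>s\<in>S. {s, z} \<notin> E})"
proof (rule ccontr)
  let ?D = "T \<union> {z \<in> V - S. \<forall>s\<in>S. {s, z} \<notin> E}"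
  let ?K = "nonneighbours V E v"
  assume "\<not> ?thesis"
  moreover have "finite ?D" "finite ?K"
    using fin S T(1) by (auto simp: nonneighbours_def intro: finite_subset[of _ V])
  ultimately obtain y where y: "\<exists>k\<in>?K. y k \<noteq> 0" "\<forall>d\<in>?D. (\<Sum>k\<in>?K. y k * A k d) = 0"
    using homogeneous_system_solution[of ?D ?K "\<lambda>d k. A k d"] by auto
  define Y where "Y q = (\<Sum>k\<in>?K. y k * A k q)" for q
  have Y: "A v p * Y q = A v q * Y p" if "p \<in> V" "q \<in> V" "{p, q} \<in> E" for p q
    unfolding Y_def sum_distrib_left
  proof (rule sum.cong)
    fix k assume "k \<in> ?K"
    then have "A v p * A k q = A v q * A k p"
      using comm that v by (auto simp: nonneighbours_def commutation_preserving_def)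
    then show "A v p * (y k * A k q) = A v q * (y k * A k p)" by algebra
  qed simp
  have Y0: "Y q = 0" if q: "q \<in> V" for q
  proof -
    consider "q \<in> ?D" | "q \<in> S - T" | "q \<notin> S" "\<exists>s\<in>S. {s, q} \<in> E" using q by auto
    then show ?thesis
    proof cases
      case 1
      then show ?thesis using y(2) by (auto simp: Y_def)
    next
      case 2
      then obtain t where "t \<in> T" "{t, q} \<in> E" using T(2) by blast
      moreover have "Y t = 0" using \<open>t \<in> T\<close> y(2) by (auto simp: Y_def)
      ultimately show ?thesis using Y[of t q] T(1) q S by auto
    next
      \<comment> \<open>Off the support \<open>A v q = 0\<close>, so the minor equation gives
        \<open>Y q = 0\<close> whatever the value of \<open>Y s\<close>.\<close>
      case 3
      then obtain s where "s \<in> S" "{s, q} \<in> E" by blast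
      then show ?thesis using Y[of s q] 3(1) q S by auto
    qed
  qed
  have "y k = 0" if k: "k \<in> ?K" for k
  proof -
    have KV: "?K \<subseteq> V" by (auto simp: nonneighbours_def)
    \<comment> \<open>Multiplication by the inverse matrix recovers the coefficient
      \<open>y k\<close> from \<open>Y\<close>.\<close>
    have "0 = (\<Sum>q\<in>V. Y q * B q k)" using Y0 by simp
    also have "\<dots> = (\<Sum>q\<in>V. \<Sum>j\<in>?K. y j * (A j q * B q k))"
      by (simp add: Y_def sum_distrib_right mult.assoc)
    also have "\<dots> = (\<Sum>j\<in>?K. y j * (\<Sum>q\<in>V. A j q * B q k))"
      by (subst sum.swap) (simp add: sum_distrib_left)
    also have "\<dots> = (\<Sum>j\<in>?K. y j * (if j = k then 1 else 0))"
    proof (rule sum.cong)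
      fix j assume "j \<in> ?K"
      then have "(\<Sum>q\<in>V. A j q * B q k) = (if j = k then 1 else 0)"
        using inv KV k unfolding inverse_matrices_def by blast
      then show "y j * (\<Sum>q\<in>V. A j q * B q k) = y j * (if j = k then 1 else 0)" by simp
    qed simp
    also have "\<dots> = y k" using k \<open>finite ?K\<close> by (simp add: if_distrib cong: if_cong)
    finally show ?thesis by simp
  qed
  with y(1) show False by blast
qed

text \<open>Maximality makes \<open>T\<close> reach every vertex of \<open>S\<close>, which is what
  the spreading of zeros requires; independence will bound the size of \<open>T\<close>.\<close>

lemma maximal_independent_subset:
  assumes "finite S" "w \<in> S" and noloop: "\<And>u. {u} \<notin> E"
  obtains T where "w \<in> T" "T \<subseteq> S" "\<And>t t'. t \<in> T \<Longrightarrow> t' \<in> T \<Longrightarrow> {t, t'} \<notin> E"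
    "\<And>q. q \<in> S - T \<Longrightarrow> \<exists>t\<in>T. {t, q} \<in> E"
proof -
  let ?F = "{T. T \<subseteq> S \<and> (\<forall>t\<in>T. \<forall>t'\<in>T. {t, t'} \<notin> E)}"
  have "finite ?F" "{w} \<in> ?F" using assms by auto
  from finite_has_maximal2[OF this] obtain T where T: "T \<in> ?F" "{w} \<subseteq> T" "\<And>T'. T' \<in> ?F \<Longrightarrow> T \<subseteq> T' \<Longrightarrow> T = T'"
    by (metis (no_types, lifting))
  show thesis
  proof
    show "\<exists>t\<in>T. {t, q} \<in> E" if q: "q \<in> S - T" for q
    proof (rule ccontr)
      assume "\<not> ?thesis"
      then have "insert q T \<in> ?F" using T(1) q noloop by (auto simp: insert_commute)
      from T(3)[OF this] q show False by auto
    qed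
  qed (use T in auto)
qed

text \<open>If \<open>T\<close> is independent and contains \<open>w\<close>, the determining set
  consists of non-neighbours of \<open>w\<close> only.\<close>

lemma nonneighbours_le_on_support:
  fixes A B :: "'a \<Rightarrow> 'a \<Rightarrow> int"
  assumes fin: "finite V" and noloop: "\<And>u. {u} \<notin> E" and inv: "inverse_matrices V A B"
    and comm: "commutation_preserving V E A"
    and v: "v \<in> V" and w: "w \<in> V" "A v w \<noteq> 0"
  shows "card (nonneighbours V E v) \<le> card (nonneighbours V E w)"
proof -
  define S where "S = {u \<in> V. A v u \<noteq> 0}"
  have "finite S" "w \<in> S" using fin w by (auto simp: S_def)
  from maximal_independent_subset[where E = E, OF this noloop] obtain T where
    T: "w \<in> T" "T \<subseteq> S" "\<And>t t'. t \<in> T \<Longrightarrow> t' \<in> T \<Longrightarrow> {t, t'} \<notin> E"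
      "\<And>q. q \<in> S - T \<Longrightarrow> \<exists>t\<in>T. {t, q} \<in> E" by blast
  let ?D = "T \<union> {z \<in> V - S. \<forall>s\<in>S. {s, z} \<notin> E}"
  have "card (nonneighbours V E v) \<le> card ?D"
    by (rule nonneighbours_le_determining_set[OF fin inv comm v S_def T(2,4)])
  also have "?D \<subseteq> nonneighbours V E w"
    using T \<open>w \<in> S\<close> by (auto simp: nonneighbours_def S_def)
  then have "card ?D \<le> card (nonneighbours V E w)"
    by (rule card_mono[rotated]) (use fin in \<open>simp add: nonneighbours_def\<close>)
  finally show ?thesis .
qed

text \<open>A vertex in the support of \<open>A v\<close> with as few non-neighbours as \<open>v\<close> leaves no room in the
  dimension count, so a second vertex of the support would dominate it.\<close>

lemma commutation_preserving_monomial: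
  fixes A B :: "'a \<Rightarrow> 'a \<Rightarrow> int"
  assumes fin: "finite V" and noloop: "\<And>u. {u} \<notin> E" and und: "undominated V E"
    and inv: "inverse_matrices V A B"
    and comm: "commutation_preserving V E A" "commutation_preserving V E B"
    and v: "v \<in> V"
  obtains u where "u \<in> V" "A v u \<noteq> 0" "\<And>w. w \<in> V \<Longrightarrow> w \<noteq> u \<Longrightarrow> A v w = 0"
proof -
  let ?nb = "nonneighbours V E"
  have finnb: "finite (?nb u)" for u using fin by (simp add: nonneighbours_def)
  have "(\<Sum>u\<in>V. A v u * B u v) \<noteq> 0" using inv v by (auto simp: inverse_matrices_def)
  \<comment> \<open>A nonzero term of the diagonal entry of \<open>A * B\<close> gives a
    \<open>u\<close> in the support of \<open>A v\<close> with \<open>v\<close> in the support of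
    \<open>B u\<close>, so the comparison holds in both directions.\<close>
  then obtain u where "u \<in> V" "A v u * B u v \<noteq> 0" by (meson sum.not_neutral_contains_not_neutral)
  then have u: "u \<in> V" "A v u \<noteq> 0" "B u v \<noteq> 0" by auto
  have le: "card (?nb u) \<le> card (?nb v)"
    by (rule nonneighbours_le_on_support[OF fin noloop inverse_matrices_sym[OF inv] comm(2) u(1) v u(3)])
  define S where "S = {u \<in> V. A v u \<noteq> 0}"
  have "finite S" "u \<in> S" using fin u by (auto simp: S_def)
  from maximal_independent_subset[where E = E, OF this noloop] obtain T where
    T: "u \<in> T" "T \<subseteq> S" "\<And>t t'. t \<in> T \<Longrightarrow> t' \<in> T \<Longrightarrow> {t, t'} \<notin> E"
      "\<And>q. q \<in> S - T \<Longrightarrow> \<exists>t\<in>T. {t, q} \<in> E" by blast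
  let ?D = "T \<union> {z \<in> V - S. \<forall>s\<in>S. {s, z} \<notin> E}"
  have "card (?nb v) \<le> card ?D"
    by (rule nonneighbours_le_determining_set[OF fin inv comm(1) v S_def T(2,4)])
  moreover have "?D \<subseteq> ?nb u"
    using T \<open>u \<in> S\<close> by (auto simp: nonneighbours_def S_def)
  \<comment> \<open>Both counts agree, so the determining set is forced to be all of
    \<open>?nb u\<close>.\<close>
  ultimately have D: "?D = ?nb u" using le by (intro card_seteq finnb) simp_all
  have "A v w = 0" if w: "w \<in> V" "w \<noteq> u" for w
  proof (rule ccontr)
    assume "A v w \<noteq> 0"
    then have wS: "w \<in> S" using w by (simp add: S_def)
    \<comment> \<open>Such a \<open>t\<close> lies in \<open>T\<close>. The witness \<open>z\<close>
      against domination of \<open>u\<close> by \<open>t\<close> lies in \<open>?nb u\<close>, hence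
      in \<open>?D\<close>, but its edge to \<open>t\<close> excludes it from both halves of
      \<open>?D\<close>.\<close>
    have nonadj: False if t: "t \<in> S" "t \<noteq> u" "{u, t} \<notin> E" for t
    proof -
      have "t \<in> ?nb u" using t by (auto simp: nonneighbours_def S_def)
      then have "t \<in> T" using D t by auto
      have "t \<in> V" using t by (simp add: S_def)
      with und u(1) t(2) obtain z where z: "z \<in> V - {u, t}" "{z, u} \<notin> E" "{z, t} \<in> E"
        unfolding undominated_def by metis
      then have "z \<in> ?nb u" by (auto simp: nonneighbours_def insert_commute)
      then have "z \<in> ?D" using D by simp
      then show False using z T(3) \<open>t \<in> T\<close> t by (auto simp: insert_commute)
    qed
    \<comment> \<open>Every other support vertex is now adjacent to \<open>u\<close>. The witness
      for \<open>u\<close> and \<open>w\<close> is not, so it falls into the half of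
      \<open>?D\<close> outside \<open>S\<close>, which forbids its edge to
      \<open>w\<close>.\<close>
    from und w u(1) obtain z where z: "z \<in> V - {u, w}" "{z, u} \<notin> E" "{z, w} \<in> E"
      unfolding undominated_def by metis
    then have "z \<in> ?nb u" by (auto simp: nonneighbours_def insert_commute)
    then have "z \<in> ?D" using D by simp
    moreover have "z \<notin> S" using nonadj[of z] z by (auto simp: insert_commute)
    ultimately show False using z wS T(2) by (auto simp: insert_commute)
  qed
  with u show thesis using that by blast
qed

section \<open>Groups given by generators and twisted conjugacy\<close>

lemma words_simps [simp]:
  "[] \<in> words X"
  "a # w \<in> words X \<longleftrightarrow> fst a \<in> X \<and> w \<in> words X"
  "u @ v \<in> words X \<longleftrightarrow> u \<in> words X \<and> v \<in> words X"
  by (cases a; auto simp: words_def)+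

lemma pres_eq_words: "pres_eq X R u v \<Longrightarrow> u \<in> words X \<and> v \<in> words X"
  by (induction rule: pres_eq.induct) auto

lemma pres_eq_context:
  assumes "pres_eq X R u v" "a \<in> words X" "b \<in> words X"
  shows "pres_eq X R (a @ u @ b) (a @ v @ b)"
  using assms
proof (induction rule: pres_eq.induct)
  case (cancel u v x c)
  then show ?case using pres_eq.cancel[of "a @ u" X "v @ b" x R c] by simp
next
  case (relator u v r)
  then show ?case using pres_eq.relator[of "a @ u" X "v @ b" r R] by simp
qed (auto intro: pres_eq.intros)

lemma pres_eq_append:
  assumes "pres_eq X R u u'" "pres_eq X R v v'"
  shows "pres_eq X R (u @ v) (u' @ v')"
proof -
  have "pres_eq X R (u @ v) (u' @ v)"
    using pres_eq_context[OF assms(1), of "[]" v] pres_eq_words[OF assms(2)] by simp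
  moreover have "pres_eq X R (u' @ v) (u' @ v')"
    using pres_eq_context[OF assms(2), of u' "[]"] pres_eq_words[OF assms(1)] by simp
  ultimately show ?thesis by (rule pres_eq.trans)
qed

definition inverse_word :: "'a word \<Rightarrow> 'a word" where
  "inverse_word w = map (\<lambda>(x, b). (x, \<not> b)) (rev w)"

lemma inverse_word_in_words: "w \<in> words X \<Longrightarrow> inverse_word w \<in> words X"
  by (induction w) (auto simp: inverse_word_def)

lemma pres_eq_inverse_word: "w \<in> words X \<Longrightarrow> pres_eq X R (inverse_word w @ w) []"
proof (induction w)
  case Nil
  then show ?case by (simp add: inverse_word_def pres_eq.refl)
next
  case (Cons a w)
  obtain x b where a: "a = (x, b)" by force
  have "pres_eq X R (inverse_word w @ [(x, \<not> b), (x, \<not> \<not> b)] @ w) (inverse_word w @ w)"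
    using Cons.prems by (intro pres_eq.cancel inverse_word_in_words) (auto simp: a)
  then show ?case using Cons by (auto simp: a inverse_word_def intro: pres_eq.trans)
qed

lemma equiv_pres_rel: "equiv (words X) (pres_rel X R)"
  by (intro equivI)
     (auto simp: pres_rel_def refl_on_def sym_def trans_def dest: pres_eq_words intro: pres_eq.intros)

definition word_class :: "'a set \<Rightarrow> 'a word set \<Rightarrow> 'a word \<Rightarrow> 'a word set" where
  "word_class X R w = pres_rel X R `` {w}"

lemma word_class_eqI: "pres_eq X R u v \<Longrightarrow> word_class X R u = word_class X R v"
  unfolding word_class_def
  by (rule equiv_class_eq[OF equiv_pres_rel]) (simp add: pres_rel_def)

lemma mem_word_class_iff: "v \<in> word_class X R u \<longleftrightarrow> pres_eq X R u v"
  by (auto simp: word_class_def pres_rel_def)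

lemma carrier_presented_group: "carrier (presented_group X R) = word_class X R ` words X"
  by (auto simp: presented_group_def quotient_def word_class_def)

lemma one_presented_group: "\<one>\<^bsub>presented_group X R\<^esub> = word_class X R []"
  by (simp add: presented_group_def word_class_def)

lemma mult_presented_group:
  assumes "u \<in> words X" "v \<in> words X"
  shows "word_class X R u \<otimes>\<^bsub>presented_group X R\<^esub> word_class X R v = word_class X R (u @ v)"
proof -
  have "word_class X R (a @ b) = word_class X R (u @ v)"
    if "a \<in> word_class X R u" "b \<in> word_class X R v" for a b
    using that by (intro word_class_eqI pres_eq.sym[OF pres_eq_append]) (auto simp: mem_word_class_iff)
  moreover have "u \<in> word_class X R u" "v \<in> word_class X R v"
    using assms by (auto simp: mem_word_class_iff intro: pres_eq.refl)
  ultimately have "(\<Union>a\<in>word_class X R u. \<Union>b\<in>word_class X R v. word_class X R (a @ b)) = word_class X R (u @ v)"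
    by blast
  then show ?thesis by (simp add: presented_group_def word_class_def)
qed

lemma group_presented_group: "group (presented_group X R)"
proof (rule groupI)
  fix x assume "x \<in> carrier (presented_group X R)"
  then obtain w where w: "x = word_class X R w" "w \<in> words X" by (auto simp: carrier_presented_group)
  then show "\<exists>y\<in>carrier (presented_group X R). y \<otimes>\<^bsub>presented_group X R\<^esub> x = \<one>\<^bsub>presented_group X R\<^esub>"
    by (intro bexI[of _ "word_class X R (inverse_word w)"])
       (auto simp: mult_presented_group one_presented_group carrier_presented_group inverse_word_in_words
         intro!: word_class_eqI pres_eq_inverse_word)
qed (auto simp: carrier_presented_group mult_presented_group one_presented_group)

primrec eval_word :: "('g, 'm) monoid_scheme \<Rightarrow> ('a \<Rightarrow> 'g) \<Rightarrow> 'a word \<Rightarrow> 'g" where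
  "eval_word G f [] = \<one>\<^bsub>G\<^esub>"
| "eval_word G f (a # w) =
     (if snd a then f (fst a) else inv\<^bsub>G\<^esub> f (fst a)) \<otimes>\<^bsub>G\<^esub> eval_word G f w"

context group
begin

lemma eval_word_closed [simp]:
  "f \<in> X \<rightarrow> carrier G \<Longrightarrow> w \<in> words X \<Longrightarrow> eval_word G f w \<in> carrier G"
  by (induction w) (auto simp: Pi_iff)

lemma eval_word_append:
  assumes "f \<in> X \<rightarrow> carrier G" "u \<in> words X" "v \<in> words X"
  shows "eval_word G f (u @ v) = eval_word G f u \<otimes> eval_word G f v"
  using assms(2)
proof (induction u)
  case (Cons a u)
  then have "f (fst a) \<in> carrier G" using assms by auto
  then show ?case using Cons assms by (auto simp: m_assoc)
qed (use assms in auto)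

lemma eval_word_pres_eq:
  assumes f: "f \<in> X \<rightarrow> carrier G" and R: "\<And>r. r \<in> R \<Longrightarrow> r \<in> words X \<Longrightarrow> eval_word G f r = \<one>"
    and "pres_eq X R u v"
  shows "eval_word G f u = eval_word G f v"
  using assms(3)
proof (induction rule: pres_eq.induct)
  case (cancel u v x b)
  have "f x \<in> carrier G" using f cancel by auto
  then have "f x \<otimes> (inv f x \<otimes> y) = y" "inv f x \<otimes> (f x \<otimes> y) = y" if "y \<in> carrier G" for y
    using that by (simp_all flip: m_assoc)
  then show ?case using cancel f by (auto simp: eval_word_append[OF f])
next
  case (relator u v r)
  then show ?case using f R by (simp add: eval_word_append[OF f])
qed auto

text \<open>Von Dyck's theorem: evaluation is constant on word classes, so an arbitrary choice of
  representative defines the homomorphism.\<close>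

lemma presented_group_hom:
  assumes f: "f \<in> X \<rightarrow> carrier G" and R: "\<And>r. r \<in> R \<Longrightarrow> r \<in> words X \<Longrightarrow> eval_word G f r = \<one>"
  obtains h where "h \<in> hom (presented_group X R) G"
    "\<And>w. w \<in> words X \<Longrightarrow> h (word_class X R w) = eval_word G f w"
proof -
  define h where "h C = eval_word G f (SOME w. w \<in> C)" for C
  have h: "h (word_class X R w) = eval_word G f w" if "w \<in> words X" for w
  proof -
    have "w \<in> word_class X R w" using that by (simp add: mem_word_class_iff pres_eq.refl)
    then have "(SOME v. v \<in> word_class X R w) \<in> word_class X R w" by (rule someI)
    then show ?thesis
      unfolding h_def mem_word_class_iff by (intro eval_word_pres_eq[OF f R, symmetric]) auto
  qed
  have "h \<in> hom (presented_group X R) G"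
    by (rule homI) (use f in \<open>auto simp: carrier_presented_group h mult_presented_group eval_word_append[OF f]\<close>)
  with h show thesis using that by blast
qed

lemma eval_commutator_word:
  assumes "f v \<in> carrier G" "f w \<in> carrier G"
  shows "eval_word G f (commutator_word v w) = f v \<otimes> f w \<otimes> inv (f v) \<otimes> inv (f w)"
  using assms by (simp add: commutator_word_def m_assoc)

lemma commutator_eq_one_iff:
  assumes "x \<in> carrier G" "y \<in> carrier G"
  shows "x \<otimes> y \<otimes> inv x \<otimes> inv y = \<one> \<longleftrightarrow> x \<otimes> y = y \<otimes> x"
proof -
  have "x \<otimes> y \<otimes> inv x \<otimes> inv y = (x \<otimes> y) \<otimes> inv (y \<otimes> x)"
    using assms by (simp add: inv_mult_group m_assoc)
  then show ?thesis using assms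
    by (metis inv_solve_right' l_one m_closed one_closed)
qed

end

lemma (in group_hom) hom_eval_word:
  "f \<in> X \<rightarrow> carrier G \<Longrightarrow> w \<in> words X \<Longrightarrow> h (eval_word G f w) = eval_word H (h \<circ> f) w"
proof (induction w)
  case (Cons a w)
  then have "f (fst a) \<in> carrier G" "eval_word G f w \<in> carrier G" by auto
  then show ?case using Cons by auto
qed auto

lemma eval_word_presented_group:
  assumes "w \<in> words X"
  shows "eval_word (presented_group X R) (\<lambda>x. word_class X R [(x, True)]) w = word_class X R w"
  using assms
proof (induction w)
  case (Cons a w)
  interpret P: group "presented_group X R" by (rule group_presented_group)
  obtain x b where a: "a = (x, b)" by force
  have x: "x \<in> X" "w \<in> words X" using Cons.prems by (auto simp: a)
  have "inv\<^bsub>presented_group X R\<^esub> word_class X R [(x, True)] = word_class X R [(x, False)]"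
  proof (rule P.inv_equality)
    have "pres_eq X R ([] @ [(x, False), (x, \<not> False)] @ []) ([] @ [])"
      by (rule pres_eq.cancel) (use x in auto)
    then have "word_class X R [(x, False), (x, True)] = word_class X R []"
      by (intro word_class_eqI) simp
    then show "word_class X R [(x, False)] \<otimes>\<^bsub>presented_group X R\<^esub> word_class X R [(x, True)]
        = \<one>\<^bsub>presented_group X R\<^esub>"
      using x by (simp add: mult_presented_group one_presented_group)
  qed (use x in \<open>auto simp: carrier_presented_group\<close>)
  then show ?case using Cons.IH x by (cases b) (auto simp: a mult_presented_group)
qed (simp add: one_presented_group)

text \<open>The generating family is part of the data, so that vertices keep their names in all
  quotients.\<close>

locale marked_group = group +
  fixes V :: "'b set" and g :: "'b \<Rightarrow> 'a"
  assumes finite_marking: "finite V"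
    and marking: "g \<in> V \<rightarrow> carrier G"
    and generated: "carrier G \<subseteq> eval_word G g ` words V"

lemma marked_presented_group:
  assumes "finite X"
  shows "marked_group (presented_group X R) X (\<lambda>x. word_class X R [(x, True)])"
proof -
  interpret group "presented_group X R" by (rule group_presented_group)
  show ?thesis
    by unfold_locales
       (use assms in \<open>auto simp: carrier_presented_group eval_word_presented_group image_iff Pi_iff\<close>)
qed

lemma (in marked_group) marked_quotient:
  assumes "M \<lhd> G"
  shows "marked_group (G Mod M) V (\<lambda>v. M #> g v)"
proof -
  interpret M: normal M G by fact
  interpret Q: group "G Mod M" by (rule M.factorgroup_is_group)
  interpret \<pi>: group_hom G "G Mod M" "\<lambda>x. M #> x"
    by unfold_locales (rule M.r_coset_hom_Mod)
  show ?thesis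
  proof unfold_locales
    show "(\<lambda>v. M #> g v) \<in> V \<rightarrow> carrier (G Mod M)" using marking by (auto simp: carrier_FactGroup)
    show "carrier (G Mod M) \<subseteq> eval_word (G Mod M) (\<lambda>v. M #> g v) ` words V"
    proof
      fix X assume "X \<in> carrier (G Mod M)"
      then obtain w where "w \<in> words V" "X = M #> eval_word G g w"
        using generated by (auto simp: carrier_FactGroup)
      then show "X \<in> eval_word (G Mod M) (\<lambda>v. M #> g v) ` words V"
        using \<pi>.hom_eval_word[OF marking] by (auto simp: o_def)
    qed
  qed (rule finite_marking)
qed

section \<open>Twisted conjugacy classes, and inversion on abelian groups\<close>

lemma equiv_twisted_conj_rel:
  fixes G (structure)
  assumes "group G" "\<phi> \<in> hom G G"
  shows "equiv (carrier G) (twisted_conj_rel G \<phi>)"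
proof -
  interpret group_hom G G \<phi>
    using assms by (auto simp: group_hom_def group_hom_axioms_def)
  show ?thesis
  proof (rule equivI)
    show "refl_on (carrier G) (twisted_conj_rel G \<phi>)"
      by (auto simp: refl_on_def twisted_conj_rel_def intro!: bexI[of _ "\<one>"])
    show "twisted_conj_rel G \<phi> \<subseteq> carrier G \<times> carrier G" by (auto simp: twisted_conj_rel_def)
    show "sym (twisted_conj_rel G \<phi>)"
    proof (rule symI)
      fix x y assume "(x, y) \<in> twisted_conj_rel G \<phi>"
      then obtain z where z: "x \<in> carrier G" "y \<in> carrier G" "z \<in> carrier G"
        "x = z \<otimes> y \<otimes> inv (\<phi> z)" by (auto simp: twisted_conj_rel_def)
      then have "y = inv z \<otimes> x \<otimes> inv (\<phi> (inv z))"
        by (simp add: m_assoc inv_solve_left)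
      then show "(y, x) \<in> twisted_conj_rel G \<phi>"
        using z by (auto simp: twisted_conj_rel_def intro!: bexI[of _ "inv z"])
    qed
    show "trans (twisted_conj_rel G \<phi>)"
    proof (rule transI)
      fix x y u assume "(x, y) \<in> twisted_conj_rel G \<phi>" "(y, u) \<in> twisted_conj_rel G \<phi>"
      then obtain z w where z: "x \<in> carrier G" "y \<in> carrier G" "u \<in> carrier G" "z \<in> carrier G" "w \<in> carrier G"
        "x = z \<otimes> y \<otimes> inv (\<phi> z)" "y = w \<otimes> u \<otimes> inv (\<phi> w)" by (auto simp: twisted_conj_rel_def)
      then have "x = (z \<otimes> w) \<otimes> u \<otimes> inv (\<phi> (z \<otimes> w))"
        by (simp add: m_assoc inv_mult_group)
      then show "(x, u) \<in> twisted_conj_rel G \<phi>"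
        using z by (auto simp: twisted_conj_rel_def intro!: bexI[of _ "z \<otimes> w"])
    qed
  qed
qed

lemma reidemeister_number_finite:
  assumes "group G" "\<phi> \<in> hom G G" "finite F" "F \<subseteq> carrier G"
    and F: "\<And>x. x \<in> carrier G \<Longrightarrow> \<exists>y\<in>F. (x, y) \<in> twisted_conj_rel G \<phi>"
  shows "reidemeister_number G \<phi> \<noteq> \<infinity>"
proof -
  have "carrier G // twisted_conj_rel G \<phi> \<subseteq> (\<lambda>y. twisted_conj_rel G \<phi> `` {y}) ` F"
    using F equiv_class_eq[OF equiv_twisted_conj_rel[OF assms(1,2)]] by (fastforce simp: quotient_def)
  then have "finite (carrier G // twisted_conj_rel G \<phi>)"
    using \<open>finite F\<close> by (meson finite_imageI finite_subset)
  then show ?thesis by (simp add: reidemeister_number_def)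
qed

lemma reidemeister_number_infinite:
  fixes f :: "nat \<Rightarrow> 'a"
  assumes "group G" "\<phi> \<in> hom G G" "range f \<subseteq> carrier G"
    and f: "\<And>k l z. z \<in> carrier G \<Longrightarrow> f k = z \<otimes>\<^bsub>G\<^esub> f l \<otimes>\<^bsub>G\<^esub> inv\<^bsub>G\<^esub> (\<phi> z) \<Longrightarrow> k = l"
  shows "reidemeister_number G \<phi> = \<infinity>"
proof -
  let ?r = "twisted_conj_rel G \<phi>"
  have "inj (\<lambda>k. ?r `` {f k})"
  proof (rule injI)
    fix k l assume "?r `` {f k} = ?r `` {f l}"
    moreover have "(f l, f l) \<in> ?r"
      using equiv_twisted_conj_rel[OF assms(1,2)] assms(3) by (auto simp: equiv_def refl_on_def)
    ultimately have "(f k, f l) \<in> ?r" by auto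
    then show "k = l" using f by (auto simp: twisted_conj_rel_def)
  qed
  moreover have "range (\<lambda>k. ?r `` {f k}) \<subseteq> carrier G // ?r"
    using assms(3) by (auto simp: quotient_def)
  ultimately have "infinite (carrier G // ?r)"
    using infinite_UNIV_nat finite_imageD finite_subset by metis
  then show ?thesis by (simp add: reidemeister_number_def)
qed

text \<open>A word longer than \<open>card V\<close> repeats a generator; the two letters multiply
  to a square (of \<open>g v\<close>, its inverse, or the identity), which is absorbed into
  \<open>z\<close>. The form \<open>z y z\<close> is chosen because it is the twisted conjugate of
  \<open>y\<close> under inversion.\<close>

lemma (in marked_group) square_times_short_word:
  assumes comm: "\<And>x y. x \<in> carrier G \<Longrightarrow> y \<in> carrier G \<Longrightarrow> x \<otimes> y = y \<otimes> x"
    and "w \<in> words V"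
  shows "\<exists>z\<in>carrier G. \<exists>w'\<in>words V. length w' \<le> card V \<and> eval_word G g w = z \<otimes> eval_word G g w' \<otimes> z"
  using \<open>w \<in> words V\<close>
proof (induction "length w" arbitrary: w rule: less_induct)
  case less
  show ?case
  proof (cases "length w \<le> card V")
    case True
    then show ?thesis using less.prems marking by (intro bexI[of _ \<one>] bexI[of _ w]) auto
  next
    case False
    have "set (map fst w) \<subseteq> V" using less.prems by (auto simp: words_def)
    then have "card (set (map fst w)) \<le> card V" by (rule card_mono[OF finite_marking])
    then have "\<not> distinct (map fst w)" using False distinct_card[of "map fst w"] by auto
    then obtain xs ys zs v where d: "map fst w = xs @ [v] @ ys @ [v] @ zs"
      using not_distinct_decomp by blast
    then obtain p w1 where w1: "w = p @ w1" "map fst w1 = v # ys @ v # zs"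
      by (auto simp: map_eq_append_conv)
    then obtain b w2 where w2: "w1 = (v, b) # w2" "map fst w2 = ys @ v # zs" by (cases w1) auto
    then obtain q w3 where w3: "w2 = q @ w3" "map fst w3 = v # zs"
      by (auto simp: map_eq_append_conv)
    then obtain c r where "w3 = (v, c) # r" by (cases w3) auto
    with w1 w2 w3 have w: "w = p @ (v, b) # q @ (v, c) # r" by simp
    have V: "v \<in> V" "p \<in> words V" "q \<in> words V" "r \<in> words V" using less.prems w by auto
    have "length (p @ q @ r) < length w" by (simp add: w)
    from less.hyps[OF this] V obtain z w' where z: "z \<in> carrier G" "w' \<in> words V" "length w' \<le> card V"
      "eval_word G g (p @ q @ r) = z \<otimes> eval_word G g w' \<otimes> z" by auto
    define e where "e b = (if b then g v else inv (g v))" for b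
    have gv: "g v \<in> carrier G" using V marking by auto
    have e: "e b \<in> carrier G" for b using gv by (simp add: e_def)
    have c: "eval_word G g p \<in> carrier G" "eval_word G g q \<in> carrier G" "eval_word G g r \<in> carrier G"
      "eval_word G g w' \<in> carrier G"
      using V z marking by auto
    interpret comm_group G using comm by unfold_locales
    have "eval_word G g w = eval_word G g p \<otimes> (e b \<otimes> (eval_word G g q \<otimes> (e c \<otimes> eval_word G g r)))"
      unfolding w using V by (simp add: eval_word_append[OF marking] e_def)
    also have "\<dots> = (e b \<otimes> e c) \<otimes> (z \<otimes> eval_word G g w' \<otimes> z)"
      unfolding z(4)[symmetric] using V c e by (simp add: eval_word_append[OF marking] m_ac)
    finally have w_eq: "eval_word G g w = (e b \<otimes> e c) \<otimes> (z \<otimes> eval_word G g w' \<otimes> z)" .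
    have "\<exists>t\<in>carrier G. e b \<otimes> e c = t \<otimes> t"
      using gv by (cases b; cases c) (auto simp: e_def intro: bexI[of _ "g v"] bexI[of _ "inv (g v)"] bexI[of _ \<one>])
    then obtain t where t: "t \<in> carrier G" "e b \<otimes> e c = t \<otimes> t" by blast
    have "eval_word G g w = (t \<otimes> z) \<otimes> eval_word G g w' \<otimes> (t \<otimes> z)"
      unfolding w_eq t(2) using t(1) z(1) c by (simp add: m_ac)
    then show ?thesis using t(1) z by blast
  qed
qed

text \<open>Inversion is the witness: the finitely many words of length at most
  \<open>card V\<close> meet all of its twisted classes.\<close>

lemma (in marked_group) abelian_not_R_infinity:
  assumes comm: "\<And>x y. x \<in> carrier G \<Longrightarrow> y \<in> carrier G \<Longrightarrow> x \<otimes> y = y \<otimes> x"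
  shows "\<not> R_infinity_property G"
proof -
  interpret comm_group G using comm by unfold_locales
  have bij: "bij_betw (m_inv G) (carrier G) (carrier G)"
    by (rule bij_betwI[of _ _ _ "m_inv G"]) auto
  have hom: "m_inv G \<in> hom G G" by (rule homI) (auto simp: inv_mult)
  have "reidemeister_number G (m_inv G) \<noteq> \<infinity>"
  proof (rule reidemeister_number_finite[OF is_group hom])
    let ?W = "{w :: 'b word. set w \<subseteq> V \<times> UNIV \<and> length w \<le> card V}"
    have W: "w \<in> ?W \<longleftrightarrow> w \<in> words V \<and> length w \<le> card V" for w
      by (auto simp: words_def)
    have "finite ?W" by (rule finite_lists_length_le) (use finite_marking in auto)
    then show "finite (eval_word G g ` ?W)" by (rule finite_imageI)
    show "eval_word G g ` ?W \<subseteq> carrier G" using W eval_word_closed[OF marking] by blast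
    fix x assume x: "x \<in> carrier G"
    then obtain w where "w \<in> words V" "x = eval_word G g w" using generated by auto
    with square_times_short_word[OF comm this(1)] obtain z w' where
      z: "z \<in> carrier G" "w' \<in> words V" "length w' \<le> card V" "x = z \<otimes> eval_word G g w' \<otimes> z" by blast
    then have "(x, eval_word G g w') \<in> twisted_conj_rel G (m_inv G)"
      using marking x by (auto simp: twisted_conj_rel_def intro!: bexI[of _ z])
    then show "\<exists>y\<in>eval_word G g ` ?W. (x, y) \<in> twisted_conj_rel G (m_inv G)"
      using z W by blast
  qed
  then show ?thesis using bij hom by (auto simp: R_infinity_property_def iso_def)
qed

section \<open>Class two quotients of right-angled Artin groups\<close>

text \<open>A central extension of integer vectors by integer matrices, with a bilinear cocycle
  supported on ordered edges. The commutator of \<open>x\<close> and \<open>y\<close> has the minor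
  of their vectors as its entry at each ordered edge. Using all functions on the type spares every
  closure condition on the carrier.\<close>

definition heisenberg :: "'a set set \<Rightarrow> (('a \<Rightarrow> int) \<times> ('a \<Rightarrow> 'a \<Rightarrow> int)) monoid" where
  "heisenberg E =
     \<lparr>carrier = UNIV,
      monoid.mult = (\<lambda>x y. (\<lambda>v. fst x v + fst y v,
                     \<lambda>v w. snd x v w + snd y v w + (if {v, w} \<in> E then fst x v * fst y w else 0))),
      one = (\<lambda>_. 0, \<lambda>_ _. 0)\<rparr>"

lemma carrier_heisenberg [simp]: "carrier (heisenberg E) = UNIV"
  by (simp add: heisenberg_def)

lemma one_heisenberg: "\<one>\<^bsub>heisenberg E\<^esub> = (\<lambda>_. 0, \<lambda>_ _. 0)"
  by (simp add: heisenberg_def)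

lemma fst_mult_heisenberg: "fst (x \<otimes>\<^bsub>heisenberg E\<^esub> y) v = fst x v + fst y v"
  by (simp add: heisenberg_def)

lemma snd_mult_heisenberg:
  "snd (x \<otimes>\<^bsub>heisenberg E\<^esub> y) v w
     = snd x v w + snd y v w + (if {v, w} \<in> E then fst x v * fst y w else 0)"
  by (simp add: heisenberg_def)

lemma heisenberg_eqI:
  "(\<And>v. fst x v = fst y v) \<Longrightarrow> (\<And>v w. snd x v w = snd y v w) \<Longrightarrow> x = y"
  for x y :: "('a \<Rightarrow> int) \<times> ('a \<Rightarrow> 'a \<Rightarrow> int)"
  by (auto simp: prod_eq_iff fun_eq_iff)

lemma group_heisenberg: "group (heisenberg E)"
proof (rule groupI)
  fix x y z :: "('a \<Rightarrow> int) \<times> ('a \<Rightarrow> 'a \<Rightarrow> int)"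
  show "x \<otimes>\<^bsub>heisenberg E\<^esub> y \<otimes>\<^bsub>heisenberg E\<^esub> z = x \<otimes>\<^bsub>heisenberg E\<^esub> (y \<otimes>\<^bsub>heisenberg E\<^esub> z)"
    by (rule heisenberg_eqI) (auto simp: fst_mult_heisenberg snd_mult_heisenberg algebra_simps)
next
  fix x :: "('a \<Rightarrow> int) \<times> ('a \<Rightarrow> 'a \<Rightarrow> int)"
  show "\<one>\<^bsub>heisenberg E\<^esub> \<otimes>\<^bsub>heisenberg E\<^esub> x = x"
    by (rule heisenberg_eqI) (auto simp: fst_mult_heisenberg snd_mult_heisenberg one_heisenberg)
  show "\<exists>y\<in>carrier (heisenberg E). y \<otimes>\<^bsub>heisenberg E\<^esub> x = \<one>\<^bsub>heisenberg E\<^esub>"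
    \<comment> \<open>The product \<open>fst x v * fst x w\<close> compensates the cocycle of the
      pair formed by the negated vector and the vector.\<close>
    by (intro bexI[of _ "(\<lambda>v. - fst x v, \<lambda>v w. - snd x v w + (if {v, w} \<in> E then fst x v * fst x w else 0))"]
          heisenberg_eqI) (auto simp: fst_mult_heisenberg snd_mult_heisenberg one_heisenberg)
qed auto

definition heisenberg_gen :: "'a \<Rightarrow> ('a \<Rightarrow> int) \<times> ('a \<Rightarrow> 'a \<Rightarrow> int)" where
  "heisenberg_gen v = (\<lambda>u. if u = v then 1 else 0, \<lambda>_ _. 0)"

text \<open>\<open>\<Phi>\<close> records the exponent sums of a word in its first component; the second component counts,
  with signs, the occurrences of \<open>v\<close> before \<open>w\<close>, for each edge \<open>{v, w}\<close>.\<close>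

locale class2_raag = marked_group +
  fixes E :: "'c set set" and \<Phi>
  assumes edges: "E \<subseteq> {{v, w} |v w. v \<in> V \<and> w \<in> V \<and> v \<noteq> w}"
    and central: "\<And>x y z. x \<in> carrier G \<Longrightarrow> y \<in> carrier G \<Longrightarrow> z \<in> carrier G \<Longrightarrow>
      (x \<otimes> y \<otimes> inv x \<otimes> inv y) \<otimes> z = z \<otimes> (x \<otimes> y \<otimes> inv x \<otimes> inv y)"
    and nonadjacent_commute: "\<And>v w. v \<in> V \<Longrightarrow> w \<in> V \<Longrightarrow> {v, w} \<notin> E \<Longrightarrow> g v \<otimes> g w = g w \<otimes> g v"
    and hom_heisenberg: "\<Phi> \<in> hom G (heisenberg E)"
    and gen_heisenberg: "\<And>v. v \<in> V \<Longrightarrow> \<Phi> (g v) = heisenberg_gen v"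
begin

sublocale \<Phi>: group_hom G "heisenberg E" \<Phi>
  using hom_heisenberg group_heisenberg by (auto simp: group_hom_def group_hom_axioms_def)

abbreviation \<epsilon> where "\<epsilon> x \<equiv> fst (\<Phi> x)"

lemma noloop: "{u} \<notin> E"
  using edges by (auto simp: doubleton_eq_iff)

lemma gen_closed: "v \<in> V \<Longrightarrow> g v \<in> carrier G"
  using marking by auto

lemma \<epsilon>_mult: "x \<in> carrier G \<Longrightarrow> y \<in> carrier G \<Longrightarrow> \<epsilon> (x \<otimes> y) u = \<epsilon> x u + \<epsilon> y u"
  by (simp add: fst_mult_heisenberg)

lemma \<epsilon>_one: "\<epsilon> \<one> u = 0"
  using one_heisenberg[of E] by simp

lemma \<epsilon>_inv:
  assumes "x \<in> carrier G" shows "\<epsilon> (inv x) u = - \<epsilon> x u"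
proof -
  have "\<epsilon> (inv x \<otimes> x) u = 0" using assms by (simp only: l_inv \<epsilon>_one)
  then show ?thesis using assms \<epsilon>_mult[of "inv x" x u] by simp
qed

lemma \<epsilon>_gen: "v \<in> V \<Longrightarrow> \<epsilon> (g v) u = (if u = v then 1 else 0)"
  by (simp add: gen_heisenberg heisenberg_gen_def)

lemma \<epsilon>_commutator:
  "x \<in> carrier G \<Longrightarrow> y \<in> carrier G \<Longrightarrow> \<epsilon> (x \<otimes> y \<otimes> inv x \<otimes> inv y) u = 0"
  by (simp add: \<epsilon>_mult \<epsilon>_inv del: \<Phi>.hom_mult \<Phi>.hom_inv)

text \<open>In the second components of \<open>x * y\<close> and \<open>y * x\<close> the additive
  parts agree, so the two cocycle values at the edge must coincide.\<close>

lemma commuting_minor: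
  assumes "x \<in> carrier G" "y \<in> carrier G" "x \<otimes> y = y \<otimes> x" "{p, q} \<in> E"
  shows "\<epsilon> x p * \<epsilon> y q = \<epsilon> x q * \<epsilon> y p"
proof -
  have "snd (\<Phi> (x \<otimes> y)) p q = snd (\<Phi> (y \<otimes> x)) p q" using assms by simp
  then show ?thesis using assms(1,2,4) by (simp add: snd_mult_heisenberg)
qed

lemma additive_determined:
  fixes h :: "'a \<Rightarrow> int"
  assumes h: "\<And>x y. x \<in> carrier G \<Longrightarrow> y \<in> carrier G \<Longrightarrow> h (x \<otimes> y) = h x + h y"
    and x: "x \<in> carrier G"
  shows "h x = (\<Sum>v\<in>V. \<epsilon> x v * h (g v))"
proof -
  have h1: "h \<one> = 0" using h[of \<one> \<one>] by simp
  have hinv: "h (inv y) = - h y" if "y \<in> carrier G" for y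
    using h[of "inv y" y] that h1 by simp
  have "h (eval_word G g w) = (\<Sum>v\<in>V. \<epsilon> (eval_word G g w) v * h (g v))" if "w \<in> words V" for w
    using that
  proof (induction w)
    case (Cons a w)
    obtain v b where a: "a = (v, b)" by force
    have v: "v \<in> V" "w \<in> words V" using Cons.prems by (auto simp: a)
    have cl: "g v \<in> carrier G" "eval_word G g w \<in> carrier G"
      using v marking by auto
    define e :: int where "e = (if b then 1 else - 1)"
    have "\<epsilon> (eval_word G g (a # w)) u = e * (if u = v then 1 else 0) + \<epsilon> (eval_word G g w) u" for u
      using cl v by (simp add: a e_def \<epsilon>_mult \<epsilon>_inv \<epsilon>_gen del: \<Phi>.hom_mult \<Phi>.hom_inv)
    then have "(\<Sum>u\<in>V. \<epsilon> (eval_word G g (a # w)) u * h (g u))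
        = (\<Sum>u\<in>V. (if u = v then e * h (g v) else 0) + \<epsilon> (eval_word G g w) u * h (g u))"
      by (intro sum.cong) (auto simp: algebra_simps)
    also have "\<dots> = e * h (g v) + h (eval_word G g w)"
      unfolding sum.distrib Cons.IH[OF v(2)] using v finite_marking by simp
    also have "\<dots> = h (eval_word G g (a # w))"
      using cl by (simp add: a e_def h hinv)
    finally show ?case by simp
  qed (simp add: h1 \<epsilon>_one del: \<Phi>.hom_one)
  then show ?thesis using x generated by auto
qed

section \<open>The derived subgroup as the kernel of the exponent sums\<close>

abbreviation G' where "G' \<equiv> derived G (carrier G)"

lemma subgroup_derived: "subgroup G' G"
  by (rule derived_is_subgroup) simp

lemma commutator_in_derived: "x \<in> carrier G \<Longrightarrow> y \<in> carrier G \<Longrightarrow> x \<otimes> y \<otimes> inv x \<otimes> inv y \<in> G'"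
  unfolding derived_def by (rule generate.incl) auto

lemma derived_subset_subgroup:
  assumes "subgroup H G" "\<And>x y. x \<in> carrier G \<Longrightarrow> y \<in> carrier G \<Longrightarrow> x \<otimes> y \<otimes> inv x \<otimes> inv y \<in> H"
  shows "G' \<subseteq> H"
  unfolding derived_def by (rule generate_subgroup_incl) (use assms in auto)

lemma derived_central: "k \<in> G' \<Longrightarrow> z \<in> carrier G \<Longrightarrow> k \<otimes> z = z \<otimes> k"
proof -
  let ?Z = "{k \<in> carrier G. \<forall>z\<in>carrier G. k \<otimes> z = z \<otimes> k}"
  have "subgroup ?Z G"
  proof (rule subgroupI)
    fix a b assume "a \<in> ?Z" "b \<in> ?Z"
    then have ab: "a \<in> carrier G" "b \<in> carrier G"
      "\<And>z. z \<in> carrier G \<Longrightarrow> a \<otimes> z = z \<otimes> a" "\<And>z. z \<in> carrier G \<Longrightarrow> b \<otimes> z = z \<otimes> b" by auto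
    have "a \<otimes> b \<otimes> z = z \<otimes> (a \<otimes> b)" if "z \<in> carrier G" for z
    proof -
      have "a \<otimes> b \<otimes> z = a \<otimes> z \<otimes> b" using ab(1,2) that ab(4)[OF that] by (simp add: m_assoc)
      then show ?thesis using ab(1,2) that ab(3)[OF that] by (simp add: m_assoc)
    qed
    then show "a \<otimes> b \<in> ?Z" using ab(1,2) by simp
  next
    fix a assume "a \<in> ?Z"
    then have a: "a \<in> carrier G" "\<And>z. z \<in> carrier G \<Longrightarrow> a \<otimes> z = z \<otimes> a" by auto
    have "inv a \<otimes> z = z \<otimes> inv a" if z: "z \<in> carrier G" for z
    proof -
      have "inv (inv z \<otimes> a) = inv (a \<otimes> inv z)" using a z by simp
      then show ?thesis using a(1) z by (simp only: inv_mult_group inv_closed inv_inv)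
    qed
    then show "inv a \<in> ?Z" using a(1) by simp
  qed auto
  then have "G' \<subseteq> ?Z" by (rule derived_subset_subgroup) (use central in auto)
  then show "k \<in> G' \<Longrightarrow> z \<in> carrier G \<Longrightarrow> k \<otimes> z = z \<otimes> k" by auto
qed

lemma exponent_sign:
  assumes "w \<in> words V" "(x, \<not> b) \<notin> set w"
  shows "(if b then 1 else - 1) * \<epsilon> (eval_word G g w) x \<ge> 0"
  using assms
proof (induction w)
  case (Cons a w)
  obtain v c where a: "a = (v, c)" by force
  have v: "v \<in> V" "w \<in> words V" using Cons.prems by (auto simp: a)
  have "g v \<in> carrier G" "eval_word G g w \<in> carrier G"
    using v marking by auto
  then show ?case using Cons v
    by (auto simp: a \<epsilon>_mult \<epsilon>_inv \<epsilon>_gen simp del: \<Phi>.hom_mult \<Phi>.hom_inv)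
qed (simp add: \<epsilon>_one del: \<Phi>.hom_one)

text \<open>Since the exponent sum of the first letter vanishes, its inverse occurs further on; cancelling
  the two letters changes the element by a commutator.\<close>

lemma exponent_kernel_word:
  assumes "w \<in> words V" "\<And>u. u \<in> V \<Longrightarrow> \<epsilon> (eval_word G g w) u = 0"
  shows "eval_word G g w \<in> G'"
  using assms
proof (induction "length w" arbitrary: w rule: less_induct)
  case less
  show ?case
  proof (cases w)
    case Nil
    then show ?thesis using subgroup.one_closed[OF subgroup_derived] by simp
  next
    case (Cons a w')
    obtain x b where a: "a = (x, b)" by force
    have x: "x \<in> V" "w' \<in> words V" using less.prems by (auto simp: Cons a)
    define e where "e = (if b then g x else inv (g x))"
    have e: "e \<in> carrier G" using gen_closed x by (simp add: e_def)
    have \<epsilon>e: "\<epsilon> e x = (if b then 1 else - 1)"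
      using x gen_closed by (simp add: e_def \<epsilon>_inv \<epsilon>_gen del: \<Phi>.hom_inv)
    have ev: "eval_word G g w = e \<otimes> eval_word G g w'" by (simp add: Cons a e_def)
    have "\<epsilon> e x + \<epsilon> (eval_word G g w') x = 0"
      using less.prems(2)[of x] x e marking by (simp add: ev \<epsilon>_mult del: \<Phi>.hom_mult)
    \<comment> \<open>Otherwise all occurrences of \<open>x\<close> in \<open>w'\<close> have the
      sign of the first letter and could not cancel its contribution.\<close>
    then have "(x, \<not> b) \<in> set w'"
      using exponent_sign[of w' x b] x \<epsilon>e by (cases b) auto
    then obtain p q where w': "w' = p @ (x, \<not> b) # q" by (meson split_list)
    have pq: "p \<in> words V" "q \<in> words V" using x w' by auto
    have cl: "eval_word G g p \<in> carrier G" "eval_word G g q \<in> carrier G"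
      using pq marking by auto
    have inv_e: "(if \<not> b then g x else inv (g x)) = inv e"
      using gen_closed x by (auto simp: e_def)
    \<comment> \<open>This is the identity e p e^-1 q = [e, p] p q.\<close>
    have split: "eval_word G g w
        = (e \<otimes> eval_word G g p \<otimes> inv e \<otimes> inv (eval_word G g p)) \<otimes> eval_word G g (p @ q)"
    proof -
      have "eval_word G g w = e \<otimes> (eval_word G g p \<otimes> (inv e \<otimes> eval_word G g q))"
        using x pq unfolding ev w' by (simp add: eval_word_append[OF marking] flip: inv_e)
      then show ?thesis using e cl pq
        by (simp add: eval_word_append[OF marking] m_assoc inv_solve_left flip: m_assoc)
           (simp add: m_assoc)
    qed
    have "\<epsilon> (eval_word G g (p @ q)) u = 0" if "u \<in> V" for u
    proof -
      have "eval_word G g (p @ q) \<in> carrier G" using pq marking by (intro eval_word_closed) auto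
      then have "\<epsilon> (eval_word G g w) u = \<epsilon> (eval_word G g (p @ q)) u"
        using e cl unfolding split by (subst \<epsilon>_mult) (simp_all add: \<epsilon>_commutator del: \<Phi>.hom_mult)
      then show ?thesis using less.prems(2)[OF that] by simp
    qed
    then have "eval_word G g (p @ q) \<in> G'"
      by (intro less.hyps) (use pq in \<open>auto simp: Cons w'\<close>)
    then show ?thesis
      unfolding split using commutator_in_derived[OF e cl(1)] subgroup.m_closed[OF subgroup_derived] by blast
  qed
qed

lemma exponent_kernel:
  assumes "x \<in> carrier G" "\<And>u. u \<in> V \<Longrightarrow> \<epsilon> x u = 0"
  shows "x \<in> G'"
  using assms generated exponent_kernel_word by auto

text \<open>Images of generators are rows, so matrices compose in reverse order: the matrix of
  \<phi> after \<psi> is that of \<psi> times that of \<phi>.\<close>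

definition exponent_matrix where "exponent_matrix \<phi> v u = \<epsilon> (\<phi> (g v)) u"

lemma exponent_hom:
  assumes "\<phi> \<in> hom G G" "x \<in> carrier G"
  shows "\<epsilon> (\<phi> x) u = (\<Sum>v\<in>V. \<epsilon> x v * exponent_matrix \<phi> v u)"
proof -
  have "\<epsilon> (\<phi> (x \<otimes> y)) u = \<epsilon> (\<phi> x) u + \<epsilon> (\<phi> y) u" if "x \<in> carrier G" "y \<in> carrier G" for x y
    using that assms(1) by (simp add: hom_mult[OF assms(1)] hom_in_carrier[OF assms(1)] \<epsilon>_mult del: \<Phi>.hom_mult)
  from additive_determined[of "\<lambda>x. \<epsilon> (\<phi> x) u", OF this assms(2)] show ?thesis
    by (simp add: exponent_matrix_def)
qed

lemma exponent_matrix_preserving: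
  assumes "\<phi> \<in> hom G G"
  shows "commutation_preserving V E (exponent_matrix \<phi>)"
  unfolding commutation_preserving_def exponent_matrix_def
proof (intro ballI impI)
  fix v w p q assume "v \<in> V" "w \<in> V" "{v, w} \<notin> E" "{p, q} \<in> E"
  then show "\<epsilon> (\<phi> (g v)) p * \<epsilon> (\<phi> (g w)) q = \<epsilon> (\<phi> (g v)) q * \<epsilon> (\<phi> (g w)) p"
    using nonadjacent_commute[of v w] gen_closed hom_mult[OF assms] hom_in_carrier[OF assms]
    by (intro commuting_minor) metis+
qed

lemma exponent_matrix_comp:
  assumes "\<phi> \<in> hom G G" "\<psi> \<in> hom G G" "\<And>x. x \<in> carrier G \<Longrightarrow> \<phi> (\<psi> x) = x" "v \<in> V" "w \<in> V"
  shows "(\<Sum>u\<in>V. exponent_matrix \<psi> v u * exponent_matrix \<phi> u w) = (if v = w then 1 else 0)"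
proof -
  have "\<psi> (g v) \<in> carrier G" using assms gen_closed hom_in_carrier by metis
  from exponent_hom[OF assms(1) this, of w] show ?thesis
    using assms gen_closed by (cases "v = w") (auto simp: exponent_matrix_def \<epsilon>_gen)
qed

lemma exponent_matrix_inverse:
  assumes "\<phi> \<in> iso G G"
  shows "inverse_matrices V (exponent_matrix \<phi>) (exponent_matrix (inv_into (carrier G) \<phi>))"
proof -
  have bij: "bij_betw \<phi> (carrier G) (carrier G)" and hom: "\<phi> \<in> hom G G"
    using assms by (auto simp: iso_def)
  have hom': "inv_into (carrier G) \<phi> \<in> hom G G"
    using iso_set_sym[OF assms] by (simp add: iso_def)
  show ?thesis
    unfolding inverse_matrices_def
    using exponent_matrix_comp[OF hom hom'] exponent_matrix_comp[OF hom' hom]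
      bij_betw_inv_into_left[OF bij] bij_betw_inv_into_right[OF bij] by auto
qed

end

section \<open>From invertible matrices to graph automorphisms\<close>

text \<open>The finite set of non-edges is mapped injectively into itself, hence onto itself, which
  leaves no room for an edge to become a non-edge. Singletons are counted among the non-edges, so
  that \<open>v = w\<close> needs no separate treatment.\<close>

lemma graph_automorphism_of_nonedges:
  assumes fin: "finite V" and E: "E \<subseteq> {{v, w} |v w. v \<in> V \<and> w \<in> V \<and> v \<noteq> w}"
    and inj: "inj_on \<sigma> V" and into: "\<sigma> ` V \<subseteq> V"
    and non: "\<And>v w. v \<in> V \<Longrightarrow> w \<in> V \<Longrightarrow> {v, w} \<notin> E \<Longrightarrow> {\<sigma> v, \<sigma> w} \<notin> E"
  shows "bij_betw \<sigma> V V" "(`) \<sigma> ` E = E"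
proof -
  show "bij_betw \<sigma> V V"
    using endo_inj_surj[OF fin into inj] inj by (simp add: bij_betw_def)
  define P where "P = {{v, w} |v w. v \<in> V \<and> w \<in> V}"
  have P: "P \<subseteq> Pow V" by (auto simp: P_def)
  have finP: "finite P" by (rule finite_subset[OF P]) (use fin in simp)
  have EP: "E \<subseteq> P" using E unfolding P_def by blast
  have injP: "inj_on ((`) \<sigma>) P"
    by (rule inj_on_subset[OF inj_on_image_Pow[OF inj] P])
  have "(`) \<sigma> ` (P - E) \<subseteq> P - E"
  proof
    fix e assume "e \<in> (`) \<sigma> ` (P - E)"
    then obtain v w where vw: "v \<in> V" "w \<in> V" "{v, w} \<notin> E" "e = {\<sigma> v, \<sigma> w}"
      by (auto simp: P_def)
    then show "e \<in> P - E" using non[of v w] into by (auto simp: P_def)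
  qed
  moreover have "finite (P - E)" using finP by (rule finite_Diff)
  moreover have "inj_on ((`) \<sigma>) (P - E)" by (rule inj_on_subset[OF injP]) (rule Diff_subset)
  ultimately have surj: "(`) \<sigma> ` (P - E) = P - E" by (intro endo_inj_surj)
  have "(`) \<sigma> ` E \<subseteq> E"
  proof
    fix e assume "e \<in> (`) \<sigma> ` E"
    then obtain f where f: "f \<in> E" "e = \<sigma> ` f" by auto
    have "e \<in> P"
    proof -
      obtain v w where "f = {v, w}" "v \<in> V" "w \<in> V" using f EP unfolding P_def by blast
      then show ?thesis using f into by (auto simp: P_def)
    qed
    show "e \<in> E"
    proof (rule ccontr)
      assume "e \<notin> E"
      then have "e \<in> (`) \<sigma> ` (P - E)" using \<open>e \<in> P\<close> surj by simp
      then obtain f' where "f' \<in> P - E" "\<sigma> ` f = \<sigma> ` f'" using f(2) by (auto simp del: Diff_iff)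
      then have "f = f'" using f(1) EP by (metis injP inj_onD DiffD1 subsetD)
      then show False using \<open>f' \<in> P - E\<close> f by simp
    qed
  qed
  moreover have "finite E" by (rule finite_subset[OF EP finP])
  moreover have "inj_on ((`) \<sigma>) E" by (rule inj_on_subset[OF injP EP])
  ultimately show "(`) \<sigma> ` E = E" by (intro endo_inj_surj)
qed

definition asymmetric_graph :: "'a set \<Rightarrow> 'a set set \<Rightarrow> bool" where
  "asymmetric_graph V E \<longleftrightarrow>
     (\<forall>\<sigma>. bij_betw \<sigma> V V \<longrightarrow> (`) \<sigma> ` E = E \<longrightarrow> (\<forall>v\<in>V. \<sigma> v = v))"

text \<open>The positions of the nonzero entries define \<sigma>. At an edge
  \<open>{\<sigma> v, \<sigma> w}\<close> one product in the minor is nonzero and the other is zero,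
  so \<open>v\<close> and \<open>w\<close> cannot commute; asymmetry then makes \<sigma> the
  identity, and an integral inverse leaves only units on the diagonal.\<close>

lemma commutation_preserving_diagonal:
  fixes A B :: "'a \<Rightarrow> 'a \<Rightarrow> int"
  assumes fin: "finite V" and E: "E \<subseteq> {{v, w} |v w. v \<in> V \<and> w \<in> V \<and> v \<noteq> w}"
    and und: "undominated V E" and asym: "asymmetric_graph V E"
    and inv: "inverse_matrices V A B"
    and comm: "commutation_preserving V E A" "commutation_preserving V E B"
    and v: "v \<in> V"
  shows "A v v \<in> {1, - 1}" and "\<And>w. w \<in> V \<Longrightarrow> w \<noteq> v \<Longrightarrow> A v w = 0"
proof -
  have noloop: "{u} \<notin> E" for u using E by (auto simp: doubleton_eq_iff)
  have "\<forall>v\<in>V. \<exists>u\<in>V. A v u \<noteq> 0 \<and> (\<forall>w\<in>V. w \<noteq> u \<longrightarrow> A v w = 0)"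
    using commutation_preserving_monomial[OF fin noloop und inv comm] by metis
  then obtain \<sigma> where \<sigma>: "\<And>v. v \<in> V \<Longrightarrow> \<sigma> v \<in> V" "\<And>v. v \<in> V \<Longrightarrow> A v (\<sigma> v) \<noteq> 0"
    "\<And>v w. v \<in> V \<Longrightarrow> w \<in> V \<Longrightarrow> w \<noteq> \<sigma> v \<Longrightarrow> A v w = 0" by metis
  have prod: "A v (\<sigma> v) * B (\<sigma> v) w = (if v = w then 1 else 0)" if "v \<in> V" "w \<in> V" for v w
  proof -
    have "(\<Sum>u\<in>V. A v u * B u w) = (\<Sum>u\<in>V. if u = \<sigma> v then A v (\<sigma> v) * B (\<sigma> v) w else 0)"
      by (intro sum.cong) (use \<sigma> that in auto)
    then show ?thesis
      using inv that \<sigma>(1) fin unfolding inverse_matrices_def by simp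
  qed
  have "inj_on \<sigma> V"
  proof (rule inj_onI, rule ccontr)
    fix v w assume vw: "v \<in> V" "w \<in> V" "\<sigma> v = \<sigma> w" "v \<noteq> w"
    then have "B (\<sigma> v) w = 0" using prod[of v w] \<sigma>(2)[of v] by simp
    then show False using prod[of w w] vw by simp
  qed
  moreover have "{\<sigma> v, \<sigma> w} \<notin> E" if "v \<in> V" "w \<in> V" "{v, w} \<notin> E" for v w
  proof
    assume e: "{\<sigma> v, \<sigma> w} \<in> E"
    then have "\<sigma> w \<noteq> \<sigma> v" using noloop by auto
    then have "A v (\<sigma> w) = 0" using \<sigma> that by simp
    moreover have "A v (\<sigma> v) * A w (\<sigma> w) = A v (\<sigma> w) * A w (\<sigma> v)"
      using comm(1) e that \<sigma>(1) unfolding commutation_preserving_def by blast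
    ultimately show False using \<sigma>(2) that by simp
  qed
  moreover have "\<sigma> ` V \<subseteq> V" using \<sigma>(1) by blast
  ultimately have "bij_betw \<sigma> V V" "(`) \<sigma> ` E = E"
    using graph_automorphism_of_nonedges[OF fin E, of \<sigma>] by simp_all
  then have \<sigma>v: "\<sigma> v = v" using asym v unfolding asymmetric_graph_def by simp
  show "A v w = 0" if "w \<in> V" "w \<noteq> v" for w using \<sigma>(3)[OF v that(1)] that \<sigma>v by simp
  have "A v v * B v v = 1" using prod[OF v v] \<sigma>v by simp
  then show "A v v \<in> {1, - 1}" by (auto simp: zmult_eq_1_iff)
qed

section \<open>Infinite Reidemeister numbers in class two\<close>

lemma (in group) mult_eq_commutator_mult:
  assumes "x \<in> carrier G" "y \<in> carrier G"
  shows "x \<otimes> y = (x \<otimes> y \<otimes> inv x \<otimes> inv y) \<otimes> (y \<otimes> x)"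
proof -
  have "x \<otimes> y \<otimes> inv x \<otimes> inv y = (x \<otimes> y) \<otimes> inv (y \<otimes> x)"
    using assms by (simp add: inv_mult_group m_assoc)
  then show ?thesis using assms by (simp add: m_assoc[of "x \<otimes> y"])
qed

context class2_raag
begin

text \<open>Modulo the central subgroup \<open>G'\<close> the map is inversion. Central factors do
  not affect commutators, and in class two the commutator of x^-1 and y^-1 equals that of x and
  y.\<close>

lemma hom_of_minus_one_fixes_derived:
  assumes \<phi>: "\<phi> \<in> hom G G" and minus: "\<And>x u. x \<in> carrier G \<Longrightarrow> u \<in> V \<Longrightarrow> \<epsilon> (\<phi> x) u = - \<epsilon> x u"
    and "k \<in> G'"
  shows "\<phi> k = k"
proof -
  interpret \<phi>: group_hom G G \<phi>
    using \<phi> by (auto simp: group_hom_def group_hom_axioms_def)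
  have "\<phi> (x \<otimes> y \<otimes> inv x \<otimes> inv y) = x \<otimes> y \<otimes> inv x \<otimes> inv y"
    if x: "x \<in> carrier G" and y: "y \<in> carrier G" for x y
  proof -
    define X Y c where "X = \<phi> x" and "Y = \<phi> y" and "c = x \<otimes> y \<otimes> inv x \<otimes> inv y"
    have cl: "X \<in> carrier G" "Y \<in> carrier G" "c \<in> carrier G" using x y by (auto simp: X_def Y_def c_def)
    \<comment> \<open>\<open>X\<close> is inverse to \<open>x\<close> modulo \<open>G'\<close>, so
      \<open>x * X\<close> and \<open>y * Y\<close> are central. The chain below moves them past the
      other factors until \<open>y * x\<close> can be cancelled on the left.\<close>
    have xX: "x \<otimes> X \<in> G'" and yY: "y \<otimes> Y \<in> G'"
      using x y minus by (auto intro!: exponent_kernel simp: X_def Y_def \<epsilon>_mult simp del: \<Phi>.hom_mult)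
    have cK: "c \<in> G'" unfolding c_def using x y by (rule commutator_in_derived)
    have xy: "x \<otimes> y = c \<otimes> (y \<otimes> x)" unfolding c_def using x y by (rule mult_eq_commutator_mult)
    have "y \<otimes> x \<otimes> (X \<otimes> Y) = y \<otimes> ((x \<otimes> X) \<otimes> Y)" using x y cl by (simp add: m_assoc)
    also have "(x \<otimes> X) \<otimes> Y = Y \<otimes> (x \<otimes> X)" by (rule derived_central[OF xX cl(2)])
    also have "y \<otimes> (Y \<otimes> (x \<otimes> X)) = (y \<otimes> Y) \<otimes> (x \<otimes> X)" using x y cl by (simp add: m_assoc)
    also have "\<dots> = (x \<otimes> X) \<otimes> (y \<otimes> Y)" using derived_central[OF yY, of "x \<otimes> X"] x cl by simp
    also have "\<dots> = x \<otimes> (X \<otimes> (y \<otimes> Y))" using x y cl by (simp add: m_assoc)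
    also have "X \<otimes> (y \<otimes> Y) = (y \<otimes> Y) \<otimes> X" using derived_central[OF yY cl(1)] by simp
    also have "x \<otimes> ((y \<otimes> Y) \<otimes> X) = (x \<otimes> y) \<otimes> (Y \<otimes> X)" using x y cl by (simp add: m_assoc)
    also have "\<dots> = (c \<otimes> (y \<otimes> x)) \<otimes> (Y \<otimes> X)" by (simp only: xy)
    also have "\<dots> = ((y \<otimes> x) \<otimes> c) \<otimes> (Y \<otimes> X)" using derived_central[OF cK, of "y \<otimes> x"] x y by simp
    also have "\<dots> = y \<otimes> x \<otimes> (c \<otimes> (Y \<otimes> X))" using x y cl by (simp add: m_assoc)
    finally have "X \<otimes> Y = c \<otimes> (Y \<otimes> X)" using x y cl by simp
    then have "X \<otimes> Y \<otimes> inv X \<otimes> inv Y = c"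
      using cl by (simp add: m_assoc)
    then show ?thesis using x y by (simp add: X_def Y_def c_def)
  qed
  moreover have "subgroup {z \<in> carrier G. \<phi> z = z} G"
    by (rule subgroupI) auto
  ultimately have "G' \<subseteq> {z \<in> carrier G. \<phi> z = z}"
    by (intro derived_subset_subgroup) auto
  then show ?thesis using \<open>k \<in> G'\<close> by blast
qed

lemma \<epsilon>_pow: "x \<in> carrier G \<Longrightarrow> \<epsilon> (x [^] (k::nat)) u = int k * \<epsilon> x u"
  by (induction k) (simp_all add: \<epsilon>_mult \<epsilon>_one algebra_simps del: \<Phi>.hom_mult \<Phi>.hom_one \<Phi>.hom_nat_pow)

lemma R_infinity:
  assumes und: "undominated V E" and asym: "asymmetric_graph V E" and "E \<noteq> {}"
  shows "R_infinity_property G"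
  unfolding R_infinity_property_def
proof
  fix \<phi> assume iso: "\<phi> \<in> iso G G"
  then have \<phi>: "\<phi> \<in> hom G G" by (simp add: iso_def)
  interpret \<phi>: group_hom G G \<phi>
    using \<phi> by (auto simp: group_hom_def group_hom_axioms_def)
  have \<psi>: "inv_into (carrier G) \<phi> \<in> hom G G"
    using iso_set_sym[OF iso] by (simp add: iso_def)
  define s where "s u = exponent_matrix \<phi> u u" for u
  note diag = commutation_preserving_diagonal[OF finite_marking edges und asym
      exponent_matrix_inverse[OF iso] exponent_matrix_preserving[OF \<phi>] exponent_matrix_preserving[OF \<psi>]]
  have s: "s u \<in> {1, - 1}" if "u \<in> V" for u
    using diag(1)[OF that] by (simp add: s_def)
  have \<epsilon>\<phi>: "\<epsilon> (\<phi> x) u = \<epsilon> x u * s u" if "x \<in> carrier G" "u \<in> V" for x u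
  proof -
    have "\<epsilon> (\<phi> x) u = (\<Sum>v\<in>V. if v = u then \<epsilon> x u * s u else 0)"
      unfolding exponent_hom[OF \<phi> that(1)]
      by (intro sum.cong) (use diag(2) that in \<open>auto simp: s_def\<close>)
    then show ?thesis using that finite_marking by simp
  qed
  show "reidemeister_number G \<phi> = \<infinity>"
  proof (cases "\<exists>v\<in>V. s v = 1")
    case True
    then obtain v where v: "v \<in> V" "s v = 1" by blast
    show ?thesis
    proof (rule reidemeister_number_infinite[OF is_group \<phi>])
      show "range (\<lambda>k::nat. g v [^] k) \<subseteq> carrier G" using gen_closed[OF v(1)] by auto
      fix k l :: nat and z
      assume z: "z \<in> carrier G" and eq: "g v [^] k = z \<otimes> g v [^] l \<otimes> inv (\<phi> z)"
      have "\<epsilon> (g v [^] k) v = \<epsilon> (z \<otimes> g v [^] l \<otimes> inv (\<phi> z)) v" by (simp only: eq)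
      \<comment> \<open>Twisting by \<open>z\<close> changes the exponent at \<open>v\<close> by the
        exponent of \<open>z\<close> minus \<open>s v\<close> times itself, which is 0 as
        \<open>s v = 1\<close>.\<close>
      then have "int k = int l"
        using z v gen_closed[OF v(1)]
        by (simp add: \<epsilon>_mult \<epsilon>_inv \<epsilon>_pow \<epsilon>_gen \<epsilon>\<phi> del: \<Phi>.hom_mult \<Phi>.hom_inv \<Phi>.hom_nat_pow)
      then show "k = l" by simp
    qed
  next
    case False
    then have minus: "\<epsilon> (\<phi> x) u = - \<epsilon> x u" if "x \<in> carrier G" "u \<in> V" for x u
      using s[OF that(2)] \<epsilon>\<phi>[OF that] that by auto
    obtain a b where ab: "a \<in> V" "b \<in> V" "a \<noteq> b" "{a, b} \<in> E" using \<open>E \<noteq> {}\<close> edges by blast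
    define c where "c = g a \<otimes> g b \<otimes> inv (g a) \<otimes> inv (g b)"
    have gab: "g a \<in> carrier G" "g b \<in> carrier G" using ab gen_closed by auto
    then have c: "c \<in> carrier G" "c \<in> G'" "\<epsilon> c u = 0" for u
      unfolding c_def using commutator_in_derived \<epsilon>_commutator by auto
    \<comment> \<open>The entry at \<open>(a, b)\<close> is 1 for \<open>g a * g b\<close> and 0 for
      the reverse product, so the commutator accounts for the difference.\<close>
    have "snd (\<Phi> (g a \<otimes> g b)) a b = snd (\<Phi> (c \<otimes> (g b \<otimes> g a))) a b"
      unfolding c_def using mult_eq_commutator_mult[OF gab] by simp
    then have c1: "snd (\<Phi> c) a b = 1"
      using gab c ab by (simp add: snd_mult_heisenberg gen_heisenberg heisenberg_gen_def)
    have pow: "snd (\<Phi> (c [^] k)) a b = int k" for k :: nat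
    proof (induction k)
      case (Suc k)
      have "snd (\<Phi> (c [^] Suc k)) a b = snd (\<Phi> (c [^] k) \<otimes>\<^bsub>heisenberg E\<^esub> \<Phi> c) a b"
        using c(1) by simp
      also have "\<dots> = int (Suc k)"
        unfolding snd_mult_heisenberg using Suc c1 c(3) by simp
      finally show ?case .
    qed (simp add: one_heisenberg)
    show ?thesis
    proof (rule reidemeister_number_infinite[OF is_group \<phi>])
      show "range (\<lambda>k::nat. c [^] k) \<subseteq> carrier G" using c by auto
      fix k l :: nat and z
      assume z: "z \<in> carrier G" and eq: "c [^] k = z \<otimes> c [^] l \<otimes> inv (\<phi> z)"
      \<comment> \<open>All exponents of \<open>c\<close> vanish and the map negates exponents, so
        the equation reads 0 = 2 * \<open>\<epsilon> z u\<close>.\<close>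
      have "\<epsilon> z u = 0" if u: "u \<in> V" for u
      proof -
        have "\<epsilon> (c [^] k) u = \<epsilon> (z \<otimes> c [^] l \<otimes> inv (\<phi> z)) u" by (simp only: eq)
        then show ?thesis using z c u
          by (simp add: \<epsilon>_mult \<epsilon>_inv \<epsilon>_pow minus del: \<Phi>.hom_mult \<Phi>.hom_inv \<Phi>.hom_nat_pow)
      qed
      then have "z \<in> G'" using exponent_kernel z by blast
      then have "\<phi> z = z" using hom_of_minus_one_fixes_derived[OF \<phi>] minus by simp
      then have "c [^] k = c [^] l"
        unfolding eq using derived_central[OF \<open>z \<in> G'\<close>, of "c [^] l"] z c(1) by (simp add: m_assoc)
      then show "k = l" using pow by (metis of_nat_eq_iff)
    qed
  qed
qed

end

section \<open>The nilpotency index of an asymmetric graph without domination\<close>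

lemma commutator_subgroup_normal:
  assumes "group G" "K \<lhd> G"
  shows "commutator_subgroup G (carrier G) K \<lhd> G"
proof -
  interpret group G by fact
  interpret K: normal K G by fact
  have KG: "k \<in> K \<Longrightarrow> k \<in> carrier G" for k by (rule K.mem_carrier)
  show ?thesis
    unfolding commutator_subgroup_def
  proof (rule normal_generateI)
    show "(\<Union>h\<in>carrier G. \<Union>k\<in>K. {h \<otimes>\<^bsub>G\<^esub> k \<otimes>\<^bsub>G\<^esub> inv\<^bsub>G\<^esub> h \<otimes>\<^bsub>G\<^esub> inv\<^bsub>G\<^esub> k}) \<subseteq> carrier G"
      using KG by auto
    fix x t assume "x \<in> (\<Union>h\<in>carrier G. \<Union>k\<in>K. {h \<otimes>\<^bsub>G\<^esub> k \<otimes>\<^bsub>G\<^esub> inv\<^bsub>G\<^esub> h \<otimes>\<^bsub>G\<^esub> inv\<^bsub>G\<^esub> k})"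
      and t: "t \<in> carrier G"
    then obtain h k where hk: "h \<in> carrier G" "k \<in> K" "x = h \<otimes>\<^bsub>G\<^esub> k \<otimes>\<^bsub>G\<^esub> inv\<^bsub>G\<^esub> h \<otimes>\<^bsub>G\<^esub> inv\<^bsub>G\<^esub> k"
      by auto
    let ?c = "\<lambda>y. t \<otimes>\<^bsub>G\<^esub> y \<otimes>\<^bsub>G\<^esub> inv\<^bsub>G\<^esub> t"
    have cmult: "?c (a \<otimes>\<^bsub>G\<^esub> b) = ?c a \<otimes>\<^bsub>G\<^esub> ?c b" if "a \<in> carrier G" "b \<in> carrier G" for a b
    proof -
      have "?c a \<otimes>\<^bsub>G\<^esub> ?c b = t \<otimes>\<^bsub>G\<^esub> a \<otimes>\<^bsub>G\<^esub> (inv\<^bsub>G\<^esub> t \<otimes>\<^bsub>G\<^esub> t) \<otimes>\<^bsub>G\<^esub> b \<otimes>\<^bsub>G\<^esub> inv\<^bsub>G\<^esub> t"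
        using that t by (simp only: m_assoc m_closed inv_closed)
      then show ?thesis using that t by (simp add: m_assoc)
    qed
    have cinv: "?c (inv\<^bsub>G\<^esub> a) = inv\<^bsub>G\<^esub> (?c a)" if "a \<in> carrier G" for a
      using that t by (simp add: inv_mult_group m_assoc)
    have "?c x = ?c h \<otimes>\<^bsub>G\<^esub> ?c k \<otimes>\<^bsub>G\<^esub> inv\<^bsub>G\<^esub> (?c h) \<otimes>\<^bsub>G\<^esub> inv\<^bsub>G\<^esub> (?c k)"
      unfolding hk(3) using hk(1) KG[OF hk(2)] by (simp only: cmult cinv m_closed inv_closed)
    moreover have "?c h \<in> carrier G" "?c k \<in> K"
      using hk t K.inv_op_closed2 by auto
    ultimately show "?c x \<in> (\<Union>h\<in>carrier G. \<Union>k\<in>K. {h \<otimes>\<^bsub>G\<^esub> k \<otimes>\<^bsub>G\<^esub> inv\<^bsub>G\<^esub> h \<otimes>\<^bsub>G\<^esub> inv\<^bsub>G\<^esub> k})"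
      by blast
  qed
qed

lemma carrier_normal: "group G \<Longrightarrow> carrier G \<lhd> G"
  by (simp add: group.normal_inv_iff group.subgroup_self monoid.m_closed group.is_monoid)

lemma lower_central_normal: "group G \<Longrightarrow> lower_central G i \<lhd> G"
  by (induction G i rule: lower_central.induct) (auto intro: commutator_subgroup_normal carrier_normal)

lemma commutator_in_commutator_subgroup:
  "h \<in> H \<Longrightarrow> k \<in> K \<Longrightarrow>
     h \<otimes>\<^bsub>G\<^esub> k \<otimes>\<^bsub>G\<^esub> inv\<^bsub>G\<^esub> h \<otimes>\<^bsub>G\<^esub> inv\<^bsub>G\<^esub> k \<in> commutator_subgroup G H K"
  unfolding commutator_subgroup_def by (rule generate.incl) auto

lemma commutator_subgroup_subset:
  assumes "group G" "subgroup L G"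
    and "\<And>h k. h \<in> H \<Longrightarrow> k \<in> K \<Longrightarrow> h \<otimes>\<^bsub>G\<^esub> k \<otimes>\<^bsub>G\<^esub> inv\<^bsub>G\<^esub> h \<otimes>\<^bsub>G\<^esub> inv\<^bsub>G\<^esub> k \<in> L"
  shows "commutator_subgroup G H K \<subseteq> L"
  unfolding commutator_subgroup_def
  by (rule group.generate_subgroup_incl) (use assms in auto)

lemma normal_coset_eq_self:
  assumes "N \<lhd> G" "x \<in> N" shows "N #>\<^bsub>G\<^esub> x = N"
proof -
  interpret normal N G by fact
  show ?thesis using assms(2) by (simp add: coset_join2 subgroup_axioms)
qed

lemma quotient_commute:
  assumes G: "group G" and N: "N \<lhd> G" and x: "x \<in> carrier G" and y: "y \<in> carrier G"
    and "x \<otimes>\<^bsub>G\<^esub> y \<otimes>\<^bsub>G\<^esub> inv\<^bsub>G\<^esub> x \<otimes>\<^bsub>G\<^esub> inv\<^bsub>G\<^esub> y \<in> N"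
  shows "(N #>\<^bsub>G\<^esub> x) \<otimes>\<^bsub>G Mod N\<^esub> (N #>\<^bsub>G\<^esub> y) = (N #>\<^bsub>G\<^esub> y) \<otimes>\<^bsub>G Mod N\<^esub> (N #>\<^bsub>G\<^esub> x)"
proof -
  interpret N: normal N G by fact
  interpret Q: group "G Mod N" by (rule N.factorgroup_is_group)
  interpret \<pi>: group_hom G "G Mod N" "\<lambda>x. N #>\<^bsub>G\<^esub> x"
    by unfold_locales (rule N.r_coset_hom_Mod)
  have "(N #>\<^bsub>G\<^esub> x) \<otimes>\<^bsub>G Mod N\<^esub> (N #>\<^bsub>G\<^esub> y) \<otimes>\<^bsub>G Mod N\<^esub> inv\<^bsub>G Mod N\<^esub> (N #>\<^bsub>G\<^esub> x) \<otimes>\<^bsub>G Mod N\<^esub> inv\<^bsub>G Mod N\<^esub> (N #>\<^bsub>G\<^esub> y)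
      = N #>\<^bsub>G\<^esub> (x \<otimes>\<^bsub>G\<^esub> y \<otimes>\<^bsub>G\<^esub> inv\<^bsub>G\<^esub> x \<otimes>\<^bsub>G\<^esub> inv\<^bsub>G\<^esub> y)"
    using x y by (simp only: \<pi>.hom_mult \<pi>.hom_inv N.m_closed N.inv_closed)
  also have "\<dots> = \<one>\<^bsub>G Mod N\<^esub>"
    using normal_coset_eq_self[OF N assms(5)] by simp
  finally show ?thesis using x y by (subst (asm) Q.commutator_eq_one_iff) (auto intro: \<pi>.hom_closed)
qed

text \<open>The index \<open>c\<close> belongs to the quotient by term \<open>c + 1\<close> of the
  series, so \<open>c = 0\<close> and \<open>c = 1\<close> are the values to exclude.\<close>

lemma index_eq_2I:
  assumes "\<not> R_infinity_property (G Mod lower_central G 1)"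
    and "\<not> R_infinity_property (G Mod lower_central G 2)"
    and "R_infinity_property (G Mod lower_central G 3)"
  shows "R_infinity_nilpotency_index G = 2"
  unfolding R_infinity_nilpotency_index_def
proof (rule antisym)
  let ?C = "{enat c |c. R_infinity_property (G Mod lower_central G (c + 1))}"
  have "enat 2 \<in> ?C" using assms(3) by (auto simp: numeral_3_eq_3 numeral_2_eq_2)
  then have "Inf ?C \<le> enat 2" by (rule Inf_lower)
  then show "Inf ?C \<le> 2" by (simp add: numeral_eq_enat)
  show "2 \<le> Inf ?C"
  proof (rule Inf_greatest)
    fix x assume "x \<in> ?C"
    then obtain c where c: "x = enat c" "R_infinity_property (G Mod lower_central G (c + 1))" by auto
    have "c \<noteq> 0" using assms(1) c(2) by (intro notI) simp
    moreover have "c \<noteq> 1" using assms(2) c(2) by (intro notI) (simp add: numeral_2_eq_2)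
    ultimately have "2 \<le> c" by simp
    then show "2 \<le> x" by (simp add: c(1) numeral_eq_enat)
  qed
qed

text \<open>Covers both the abelianization and the trivial quotient by the first term of the
  series.\<close>

lemma (in marked_group) quotient_not_R_infinity:
  assumes M: "M \<lhd> G" and "lower_central G 2 \<subseteq> M"
  shows "\<not> R_infinity_property (G Mod M)"
proof -
  interpret Q: marked_group "G Mod M" V "\<lambda>v. M #> g v" using M by (rule marked_quotient)
  show ?thesis
  proof (rule Q.abelian_not_R_infinity)
    fix X Y assume "X \<in> carrier (G Mod M)" "Y \<in> carrier (G Mod M)"
    then obtain x y where xy: "x \<in> carrier G" "y \<in> carrier G" "X = M #> x" "Y = M #> y"
      by (auto simp: carrier_FactGroup)
    have "x \<otimes> y \<otimes> inv x \<otimes> inv y \<in> M"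
      using assms(2) xy commutator_in_commutator_subgroup[of x "carrier G" y "carrier G" G]
      by (auto simp: numeral_2_eq_2)
    then show "X \<otimes>\<^bsub>G Mod M\<^esub> Y = Y \<otimes>\<^bsub>G Mod M\<^esub> X"
      unfolding xy(3,4) by (rule quotient_commute[OF is_group M xy(1,2)])
  qed
qed

text \<open>For non-adjacent generators the cocycle vanishes in both orders, so the defining
  relators hold in the model.\<close>

lemma raag_heisenberg_hom:
  assumes "E \<subseteq> {{v, w} |v w. v \<in> V \<and> w \<in> V \<and> v \<noteq> w}"
  obtains h where "h \<in> hom (raag (V, E)) (heisenberg E)"
    "\<And>v. v \<in> V \<Longrightarrow> h (word_class V {commutator_word v w |v w. v \<in> V \<and> w \<in> V \<and> {v, w} \<notin> E} [(v, True)]) = heisenberg_gen v"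
proof -
  let ?R = "{commutator_word v w |v w. v \<in> V \<and> w \<in> V \<and> {v, w} \<notin> E}"
  interpret H: group "heisenberg E" by (rule group_heisenberg)
  have gen: "heisenberg_gen \<in> V \<rightarrow> carrier (heisenberg E)" by simp
  have "eval_word (heisenberg E) heisenberg_gen r = \<one>\<^bsub>heisenberg E\<^esub>" if r: "r \<in> ?R" for r
  proof -
    obtain v w where vw: "r = commutator_word v w" "{v, w} \<notin> E" using r by auto
    have "heisenberg_gen v \<otimes>\<^bsub>heisenberg E\<^esub> heisenberg_gen w
        = heisenberg_gen w \<otimes>\<^bsub>heisenberg E\<^esub> heisenberg_gen v"
      by (rule heisenberg_eqI)
         (use vw(2) in \<open>auto simp: fst_mult_heisenberg snd_mult_heisenberg heisenberg_gen_def insert_commute\<close>)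
    then show ?thesis
      unfolding vw(1) by (subst H.eval_commutator_word, simp, simp, subst H.commutator_eq_one_iff) simp_all
  qed
  from H.presented_group_hom[OF gen this] obtain h where
    h: "h \<in> hom (presented_group V ?R) (heisenberg E)"
      "\<And>w. w \<in> words V \<Longrightarrow> h (word_class V ?R w) = eval_word (heisenberg E) heisenberg_gen w"
    by blast
  show thesis
  proof (rule that)
    show "h \<in> hom (raag (V, E)) (heisenberg E)" using h(1) by (simp add: raag_def)
    show "h (word_class V ?R [(v, True)]) = heisenberg_gen v" if "v \<in> V" for v
      using h(2)[of "[(v, True)]"] that by simp
  qed
qed

lemma heisenberg_commute:
  assumes "fst y = (\<lambda>_. 0)"
  shows "x \<otimes>\<^bsub>heisenberg E\<^esub> y = y \<otimes>\<^bsub>heisenberg E\<^esub> x"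
  by (rule heisenberg_eqI) (use assms in \<open>auto simp: fst_mult_heisenberg snd_mult_heisenberg\<close>)

text \<open>The model has class two: \<open>h\<close> sends commutators to elements with zero
  vector, and these are central. Hence \<open>h\<close> descends to the quotient by
  \<open>\<gamma>\<^sub>3\<close>.\<close>

lemma lower_central_3_heisenberg:
  assumes "group G" and h: "h \<in> hom G (heisenberg E)"
  shows "lower_central G 3 \<subseteq> kernel G (heisenberg E) h"
proof -
  interpret H: group "heisenberg E" by (rule group_heisenberg)
  interpret h: group_hom G "heisenberg E" h
    using assms H.is_group by (auto simp: group_hom_def group_hom_axioms_def)
  let ?L = "{x \<in> carrier G. fst (h x) = (\<lambda>_. 0)}"
  have inv0: "fst (inv\<^bsub>heisenberg E\<^esub> a) v = - fst a v" for a :: "('c \<Rightarrow> int) \<times> ('c \<Rightarrow> 'c \<Rightarrow> int)" and v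
  proof -
    have "0 = fst (inv\<^bsub>heisenberg E\<^esub> a \<otimes>\<^bsub>heisenberg E\<^esub> a) v" by (simp add: one_heisenberg)
    also have "\<dots> = fst (inv\<^bsub>heisenberg E\<^esub> a) v + fst a v" by (rule fst_mult_heisenberg)
    finally show ?thesis by simp
  qed
  have L: "subgroup ?L G"
    by (rule h.subgroupI)
       (auto simp: fun_eq_iff fst_mult_heisenberg inv0 one_heisenberg intro!: exI[of _ "\<one>\<^bsub>G\<^esub>"])
  have L2: "lower_central G 2 \<subseteq> ?L"
    unfolding numeral_2_eq_2 lower_central.simps
    by (rule commutator_subgroup_subset[OF assms(1) L]) (auto simp: fun_eq_iff fst_mult_heisenberg inv0)
  show ?thesis
    unfolding numeral_3_eq_3 lower_central.simps
  proof (rule commutator_subgroup_subset[OF assms(1) h.subgroup_kernel])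
    fix x k assume x: "x \<in> carrier G" and "k \<in> commutator_subgroup G (carrier G) (carrier G)"
    then have k: "k \<in> carrier G" "fst (h k) = (\<lambda>_. 0)"
      using L2 by (auto simp: numeral_2_eq_2)
    have "h (x \<otimes>\<^bsub>G\<^esub> k \<otimes>\<^bsub>G\<^esub> inv\<^bsub>G\<^esub> x \<otimes>\<^bsub>G\<^esub> inv\<^bsub>G\<^esub> k)
        = h x \<otimes>\<^bsub>heisenberg E\<^esub> h k \<otimes>\<^bsub>heisenberg E\<^esub> inv\<^bsub>heisenberg E\<^esub> h x \<otimes>\<^bsub>heisenberg E\<^esub> inv\<^bsub>heisenberg E\<^esub> h k"
      using x k by simp
    also have "\<dots> = \<one>\<^bsub>heisenberg E\<^esub>"
      by (subst H.commutator_eq_one_iff) (auto intro: heisenberg_commute[OF k(2)])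
    finally have "h (x \<otimes>\<^bsub>G\<^esub> k \<otimes>\<^bsub>G\<^esub> inv\<^bsub>G\<^esub> x \<otimes>\<^bsub>G\<^esub> inv\<^bsub>G\<^esub> k) = \<one>\<^bsub>heisenberg E\<^esub>" .
    then show "x \<otimes>\<^bsub>G\<^esub> k \<otimes>\<^bsub>G\<^esub> inv\<^bsub>G\<^esub> x \<otimes>\<^bsub>G\<^esub> inv\<^bsub>G\<^esub> k \<in> kernel G (heisenberg E) h"
      using x k by (simp add: kernel_def)
  qed
qed

theorem raag_index_eq_2:
  fixes V :: "'a set"
  assumes graph: "is_graph (V, E)" and "undominated V E" "asymmetric_graph V E" "E \<noteq> {}"
  shows "R_infinity_nilpotency_index (raag (V, E)) = 2"
proof -
  define R where "R = {commutator_word v w |v w. v \<in> V \<and> w \<in> V \<and> {v, w} \<notin> E}"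
  define G where "G = raag (V, E)"
  have G: "G = presented_group V R" by (simp add: G_def raag_def R_def)
  define x where "x v = word_class V R [(v, True)]" for v
  have edges: "E \<subseteq> {{v, w} |v w. v \<in> V \<and> w \<in> V \<and> v \<noteq> w}" and fin: "finite V"
    using graph by (auto simp: is_graph_def)
  interpret marked_group G V x
    unfolding G x_def by (rule marked_presented_group[OF fin])
  obtain h where h: "h \<in> hom G (heisenberg E)" "\<And>v. v \<in> V \<Longrightarrow> h (x v) = heisenberg_gen v"
    using raag_heisenberg_hom[OF edges] unfolding G_def x_def R_def by blast
  let ?N = "lower_central G 3"
  interpret N: normal ?N G by (rule lower_central_normal) (rule is_group)
  interpret H: group "heisenberg E" by (rule group_heisenberg)
  interpret h: group_hom G "heisenberg E" h
    using h(1) by unfold_locales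
  obtain \<Phi> where \<Phi>: "\<Phi> \<in> hom (G Mod ?N) (heisenberg E)" "\<And>y. y \<in> carrier G \<Longrightarrow> \<Phi> (?N #>\<^bsub>G\<^esub> y) = h y"
    using h.FactGroup_universal_kernel[OF N.normal_axioms lower_central_3_heisenberg[OF is_group h(1)]]
    by blast
  interpret Q: marked_group "G Mod ?N" V "\<lambda>v. ?N #>\<^bsub>G\<^esub> x v"
    by (rule marked_quotient) (rule N.normal_axioms)
  interpret \<pi>: group_hom G "G Mod ?N" "\<lambda>x. ?N #>\<^bsub>G\<^esub> x"
    by unfold_locales (rule N.r_coset_hom_Mod)
  interpret Q: class2_raag "G Mod ?N" V "\<lambda>v. ?N #>\<^bsub>G\<^esub> x v" E \<Phi>
  proof unfold_locales
    show "E \<subseteq> {{v, w} |v w. v \<in> V \<and> w \<in> V \<and> v \<noteq> w}" by (rule edges)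
    show "\<Phi> \<in> hom (G Mod ?N) (heisenberg E)" by (rule \<Phi>(1))
    show "\<Phi> (?N #>\<^bsub>G\<^esub> x v) = heisenberg_gen v" if "v \<in> V" for v
      using \<Phi>(2)[OF funcset_mem[OF marking that]] h(2)[OF that] by simp
  next
    fix v w assume vw: "v \<in> V" "w \<in> V" "{v, w} \<notin> E"
    have cl: "x v \<in> carrier G" "x w \<in> carrier G" using vw marking by auto
    have "commutator_word v w \<in> words V" using vw by (simp add: commutator_word_def)
    then have "eval_word G x (commutator_word v w) = word_class V R (commutator_word v w)"
      unfolding G x_def by (rule eval_word_presented_group)
    also have "\<dots> = word_class V R []"
    proof (rule word_class_eqI)
      have "pres_eq V R ([] @ commutator_word v w @ []) ([] @ [])"
        using vw \<open>commutator_word v w \<in> words V\<close> by (intro pres_eq.relator) (auto simp: R_def)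
      then show "pres_eq V R (commutator_word v w) []" by simp
    qed
    also have "\<dots> = \<one>\<^bsub>G\<^esub>" by (simp add: G one_presented_group)
    finally have "x v \<otimes>\<^bsub>G\<^esub> x w = x w \<otimes>\<^bsub>G\<^esub> x v"
      using cl by (simp add: eval_commutator_word commutator_eq_one_iff)
    then show "(?N #>\<^bsub>G\<^esub> x v) \<otimes>\<^bsub>G Mod ?N\<^esub> (?N #>\<^bsub>G\<^esub> x w) = (?N #>\<^bsub>G\<^esub> x w) \<otimes>\<^bsub>G Mod ?N\<^esub> (?N #>\<^bsub>G\<^esub> x v)"
      using cl \<pi>.hom_mult by metis
  next
    fix X Y Z assume "X \<in> carrier (G Mod ?N)" "Y \<in> carrier (G Mod ?N)" "Z \<in> carrier (G Mod ?N)"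
    then obtain a b z where abz: "a \<in> carrier G" "b \<in> carrier G" "z \<in> carrier G"
      "X = ?N #>\<^bsub>G\<^esub> a" "Y = ?N #>\<^bsub>G\<^esub> b" "Z = ?N #>\<^bsub>G\<^esub> z"
      by (auto simp: carrier_FactGroup)
    let ?c = "a \<otimes>\<^bsub>G\<^esub> b \<otimes>\<^bsub>G\<^esub> inv\<^bsub>G\<^esub> a \<otimes>\<^bsub>G\<^esub> inv\<^bsub>G\<^esub> b"
    have c: "?c \<in> carrier G" using abz by simp
    have C: "X \<otimes>\<^bsub>G Mod ?N\<^esub> Y \<otimes>\<^bsub>G Mod ?N\<^esub> inv\<^bsub>G Mod ?N\<^esub> X \<otimes>\<^bsub>G Mod ?N\<^esub> inv\<^bsub>G Mod ?N\<^esub> Y = ?N #>\<^bsub>G\<^esub> ?c"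
      using abz by (simp only: \<pi>.hom_mult \<pi>.hom_inv m_closed inv_closed)
    have "?c \<in> lower_central G 2"
      using commutator_in_commutator_subgroup[of a "carrier G" b "carrier G" G] abz
      by (simp add: numeral_2_eq_2)
    then have "z \<otimes>\<^bsub>G\<^esub> ?c \<otimes>\<^bsub>G\<^esub> inv\<^bsub>G\<^esub> z \<otimes>\<^bsub>G\<^esub> inv\<^bsub>G\<^esub> ?c \<in> ?N"
      using commutator_in_commutator_subgroup[of z "carrier G" ?c "lower_central G 2" G] abz
      by (simp add: numeral_2_eq_2 numeral_3_eq_3)
    from quotient_commute[OF is_group N.normal_axioms abz(3) c this]
    show "X \<otimes>\<^bsub>G Mod ?N\<^esub> Y \<otimes>\<^bsub>G Mod ?N\<^esub> inv\<^bsub>G Mod ?N\<^esub> X \<otimes>\<^bsub>G Mod ?N\<^esub> inv\<^bsub>G Mod ?N\<^esub> Y \<otimes>\<^bsub>G Mod ?N\<^esub> Z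
        = Z \<otimes>\<^bsub>G Mod ?N\<^esub> (X \<otimes>\<^bsub>G Mod ?N\<^esub> Y \<otimes>\<^bsub>G Mod ?N\<^esub> inv\<^bsub>G Mod ?N\<^esub> X \<otimes>\<^bsub>G Mod ?N\<^esub> inv\<^bsub>G Mod ?N\<^esub> Y)"
      unfolding C abz(6) by simp
  qed
  show ?thesis
    unfolding G_def[symmetric]
  proof (rule index_eq_2I)
    show "R_infinity_property (G Mod ?N)" using assms(2-4) by (rule Q.R_infinity)
    show "\<not> R_infinity_property (G Mod lower_central G 2)"
      by (rule quotient_not_R_infinity[OF lower_central_normal[OF is_group]]) simp
    have "lower_central G 2 \<subseteq> lower_central G 1"
      using subgroup.subset[OF normal_imp_subgroup[OF lower_central_normal[OF is_group]]] by simp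
    then show "\<not> R_infinity_property (G Mod lower_central G 1)"
      by (rule quotient_not_R_infinity[OF lower_central_normal[OF is_group]])
  qed
qed

section \<open>Counting labelled graphs\<close>

locale permutation_action =
  fixes A :: "'p set" and X :: "'x set" and act :: "('p \<Rightarrow> 'p) \<Rightarrow> 'x \<Rightarrow> 'x" and r :: "('x \<times> 'x) set"
  assumes finite_A: "finite A" and finite_X: "finite X"
    and act_closed: "\<And>\<pi> x. \<pi> permutes A \<Longrightarrow> x \<in> X \<Longrightarrow> act \<pi> x \<in> X"
    and act_id: "\<And>x. x \<in> X \<Longrightarrow> act id x = x"
    and act_comp: "\<And>\<pi> \<tau> x. \<pi> permutes A \<Longrightarrow> \<tau> permutes A \<Longrightarrow> x \<in> X \<Longrightarrow> act (\<pi> \<circ> \<tau>) x = act \<pi> (act \<tau> x)"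
    and r: "r = {(x, y). x \<in> X \<and> y \<in> X \<and> (\<exists>\<pi>. \<pi> permutes A \<and> y = act \<pi> x)}"
begin

lemma act_inv: "\<pi> permutes A \<Longrightarrow> x \<in> X \<Longrightarrow> act (inv_into UNIV \<pi>) (act \<pi> x) = x"
  using act_comp[of "inv_into UNIV \<pi>" \<pi> x] by (simp add: permutes_inv permutes_inv_o act_id)

lemma equiv_r: "equiv X r"
proof (rule equivI)
  show "r \<subseteq> X \<times> X" by (auto simp: r)
  show "refl_on X r" unfolding r refl_on_def using act_id permutes_id by fastforce
  show "sym r"
  proof (rule symI)
    fix x y assume "(x, y) \<in> r"
    then obtain \<pi> where "x \<in> X" "y \<in> X" "\<pi> permutes A" "y = act \<pi> x" by (auto simp: r)
    then show "(y, x) \<in> r"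
      using act_inv[of \<pi> x] permutes_inv[of \<pi> A] by (auto simp: r intro!: exI[of _ "inv_into UNIV \<pi>"])
  qed
  show "trans r"
  proof (rule transI)
    fix x y z assume "(x, y) \<in> r" "(y, z) \<in> r"
    then obtain \<pi> \<tau> where "x \<in> X" "z \<in> X" "\<pi> permutes A" "\<tau> permutes A" "z = act \<tau> (act \<pi> x)"
      by (auto simp: r)
    then show "(x, z) \<in> r"
      using act_comp[of \<tau> \<pi> x] permutes_compose[of \<pi> A \<tau>] by (auto simp: r intro!: exI[of _ "\<tau> \<circ> \<pi>"])
  qed
qed

text \<open>The permutation \<open>t x\<close> is a chosen transporter from the representative of
  the orbit to \<open>x\<close>; both counts below encode points by it.\<close>

lemma orbit_representatives:
  obtains rep t where "\<And>C. C \<in> X // r \<Longrightarrow> rep C \<in> X \<and> r `` {rep C} = C"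
    "\<And>x. x \<in> X \<Longrightarrow> t x permutes A \<and> act (t x) (rep (r `` {x})) = x"
proof -
  have "\<forall>C\<in>X // r. \<exists>x\<in>X. r `` {x} = C" by (auto simp: quotient_def)
  then obtain rep where rep: "\<And>C. C \<in> X // r \<Longrightarrow> rep C \<in> X \<and> r `` {rep C} = C" by metis
  have "\<exists>\<pi>. \<pi> permutes A \<and> act \<pi> (rep (r `` {x})) = x" if "x \<in> X" for x
  proof -
    have "r `` {x} \<in> X // r" using that by (rule quotientI)
    then have "r `` {rep (r `` {x})} = r `` {x}" using rep by blast
    then have "(rep (r `` {x}), x) \<in> r" using eq_equiv_class[OF _ equiv_r that] by blast
    then show ?thesis by (auto simp: r)
  qed
  then obtain t where "\<And>x. x \<in> X \<Longrightarrow> t x permutes A \<and> act (t x) (rep (r `` {x})) = x" by metis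
  with rep show thesis using that by blast
qed

lemma finite_permutations_A: "finite {\<pi>. \<pi> permutes A}"
  using finite_permutations[OF finite_A] .

text \<open>Half of Burnside's lemma. With \<open>y\<close> the image of \<open>rep C\<close> under
  \<pi>, both \<pi> and \<open>t y\<close> carry \<open>rep C\<close> to \<open>y\<close>, so \<pi>
  after the inverse of \<open>t y\<close> fixes \<open>y\<close>. From this pair, \<open>y\<close>
  gives back \<open>C\<close>, and then \<open>t y\<close> gives back \<pi>.\<close>

lemma orbits_le_sum_fixed_points:
  "card (X // r) * card {\<pi>. \<pi> permutes A}
     \<le> (\<Sum>\<pi> | \<pi> permutes A. card {x \<in> X. act \<pi> x = x})"
proof -
  let ?S = "{\<pi>. \<pi> permutes A}"
  obtain rep t where rep: "\<And>C. C \<in> X // r \<Longrightarrow> rep C \<in> X \<and> r `` {rep C} = C"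
    and t: "\<And>x. x \<in> X \<Longrightarrow> t x permutes A \<and> act (t x) (rep (r `` {x})) = x"
    using orbit_representatives by blast
  define F where "F = (\<lambda>(C, \<pi>). let y = act \<pi> (rep C) in (\<pi> \<circ> inv_into UNIV (t y), y))"
  have cls: "act \<pi> (rep C) \<in> X" "r `` {act \<pi> (rep C)} = C" if "C \<in> X // r" "\<pi> permutes A" for C \<pi>
  proof -
    show X: "act \<pi> (rep C) \<in> X" using act_closed rep that by blast
    then have "(rep C, act \<pi> (rep C)) \<in> r" using rep[OF that(1)] that(2) by (auto simp: r)
    then show "r `` {act \<pi> (rep C)} = C" using equiv_class_eq[OF equiv_r] rep[OF that(1)] by metis
  qed
  have "card ((X // r) \<times> ?S) \<le> card (SIGMA \<pi>:?S. {x \<in> X. act \<pi> x = x})"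
  proof (rule card_inj_on_le)
    show "inj_on F ((X // r) \<times> ?S)"
    proof (rule inj_onI, clarsimp)
      fix C \<pi> C' \<pi>'
      assume C: "C \<in> X // r" "C' \<in> X // r" and \<pi>: "\<pi> permutes A" "\<pi>' permutes A"
        and eq: "F (C, \<pi>) = F (C', \<pi>')"
      have y: "act \<pi> (rep C) = act \<pi>' (rep C')" using eq by (simp add: F_def Let_def)
      then have "C = C'" using cls(2)[OF C(1) \<pi>(1)] cls(2)[OF C(2) \<pi>(2)] by simp
      moreover have "\<pi> = \<pi>'"
      proof -
        define y where "y = act \<pi> (rep C)"
        have ty: "t y permutes A" using t cls(1)[OF C(1) \<pi>(1)] by (simp add: y_def)
        have "\<pi> \<circ> inv_into UNIV (t y) = \<pi>' \<circ> inv_into UNIV (t y)" using eq y by (simp add: F_def Let_def y_def)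
        then have "\<pi> \<circ> inv_into UNIV (t y) \<circ> t y = \<pi>' \<circ> inv_into UNIV (t y) \<circ> t y" by simp
        then show ?thesis using permutes_inv_o(2)[OF ty] by (simp add: o_assoc[symmetric])
      qed
      ultimately show "C = C' \<and> \<pi> = \<pi>'" by simp
    qed
    show "F ` ((X // r) \<times> ?S) \<subseteq> (SIGMA \<pi>:?S. {x \<in> X. act \<pi> x = x})"
    proof (clarsimp simp: F_def Let_def)
      fix C \<pi> assume C: "C \<in> X // r" and \<pi>: "\<pi> permutes A"
      define y where "y = act \<pi> (rep C)"
      have y: "y \<in> X" "r `` {y} = C" using cls[OF C \<pi>] by (simp_all add: y_def)
      have ty: "t y permutes A" "act (t y) (rep C) = y" using t[OF y(1)] y(2) by auto
      have "act (inv_into UNIV (t y)) y = rep C" using act_inv[OF ty(1)] rep[OF C] ty(2) by metis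
      then have "act (\<pi> \<circ> inv_into UNIV (t y)) y = y"
        using act_comp[OF \<pi> permutes_inv[OF ty(1)] y(1)] by (simp add: y_def)
      then show "\<pi> \<circ> inv_into UNIV (t (act \<pi> (rep C))) permutes A \<and> act \<pi> (rep C) \<in> X \<and>
          act (\<pi> \<circ> inv_into UNIV (t (act \<pi> (rep C)))) (act \<pi> (rep C)) = act \<pi> (rep C)"
        using y(1) permutes_compose[OF permutes_inv[OF ty(1)] \<pi>] by (simp add: y_def)
    qed
    show "finite (SIGMA \<pi>:?S. {x \<in> X. act \<pi> x = x})"
      using finite_permutations_A finite_X by (intro finite_SigmaI) auto
  qed
  also have "\<dots> = (\<Sum>\<pi> | \<pi> permutes A. card {x \<in> X. act \<pi> x = x})"
    using finite_permutations_A finite_X by (intro card_SigmaI) auto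
  finally show ?thesis by (simp add: card_cartesian_product)
qed

text \<open>A point is determined by its orbit and its transporter, so no orbit is larger than the
  set of permutations.\<close>

lemma card_le_orbits_meeting:
  assumes "Y \<subseteq> X"
  shows "card Y \<le> card {C \<in> X // r. \<exists>x\<in>C. x \<in> Y} * card {\<pi>. \<pi> permutes A}"
proof -
  let ?S = "{\<pi>. \<pi> permutes A}"
  obtain rep t where "\<And>C. C \<in> X // r \<Longrightarrow> rep C \<in> X \<and> r `` {rep C} = C"
    and t: "\<And>x. x \<in> X \<Longrightarrow> t x permutes A \<and> act (t x) (rep (r `` {x})) = x"
    using orbit_representatives by blast
  have "card Y \<le> card ({C \<in> X // r. \<exists>x\<in>C. x \<in> Y} \<times> ?S)"
  proof (rule card_inj_on_le)
    show "inj_on (\<lambda>x. (r `` {x}, t x)) Y"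
    proof (rule inj_onI)
      fix x y assume xy: "x \<in> Y" "y \<in> Y" and eq: "(r `` {x}, t x) = (r `` {y}, t y)"
      have "x = act (t x) (rep (r `` {x}))" "y = act (t y) (rep (r `` {y}))" using t xy assms by auto
      then show "x = y" using eq by simp
    qed
    show "(\<lambda>x. (r `` {x}, t x)) ` Y \<subseteq> {C \<in> X // r. \<exists>x\<in>C. x \<in> Y} \<times> ?S"
    proof clarsimp
      fix x assume x: "x \<in> Y"
      then have "x \<in> X" using assms by blast
      then show "r `` {x} \<in> X // r \<and> (\<exists>y\<in>r `` {x}. y \<in> Y) \<and> t x permutes A"
        using x t equiv_class_self[OF equiv_r] by (metis quotientI)
    qed
    have "finite (X // r)" using finite_X equiv_r by (intro finite_quotient) (auto simp: equiv_def)
    then show "finite ({C \<in> X // r. \<exists>x\<in>C. x \<in> Y} \<times> ?S)" using finite_permutations_A by simp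
  qed
  then show ?thesis by (simp add: card_cartesian_product)
qed

end

section \<open>Edge sets invariant under a permutation\<close>

text \<open>Let \<open>R\<close> be a maximal set of moved points containing no point together with
  its image; its size is \<open>k\<close>. By maximality each moved point lies in \<open>R\<close>,
  in its image or in its preimage, whence the factor 3. An invariant set is determined off
  \<open>R\<close>, since \<open>e\<close> belongs to it exactly if \<open>f e\<close> does, and
  \<open>f e\<close> is outside \<open>R\<close>.\<close>

lemma card_invariant_subsets:
  assumes fin: "finite P" and inj: "inj_on f P" and f: "f ` P \<subseteq> P"
  obtains k where "card {e \<in> P. f e \<noteq> e} \<le> 3 * k" "k \<le> card P"
    "card {E. E \<subseteq> P \<and> f ` E = E} \<le> 2 ^ (card P - k)"
proof -
  define Q where "Q = {e \<in> P. f e \<noteq> e}"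
  let ?F = "{R. R \<subseteq> Q \<and> (\<forall>e\<in>R. f e \<notin> R)}"
  have "finite ?F" "{} \<in> ?F" using fin by (auto simp: Q_def)
  from finite_has_maximal2[OF this] obtain R where
    R: "R \<in> ?F" "\<And>R'. R' \<in> ?F \<Longrightarrow> R \<subseteq> R' \<Longrightarrow> R = R'"
    by (metis (no_types, lifting))
  have RQ: "R \<subseteq> Q" and Rf: "\<And>e. e \<in> R \<Longrightarrow> f e \<notin> R" using R(1) by auto
  have RP: "R \<subseteq> P" using RQ by (auto simp: Q_def)
  have finR: "finite R" using RP fin by (rule finite_subset)
  let ?B = "{e \<in> P. f e \<in> R}"
  have "Q \<subseteq> R \<union> f ` R \<union> ?B"
  proof
    fix e assume e: "e \<in> Q"
    show "e \<in> R \<union> f ` R \<union> ?B"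
    proof (rule ccontr)
      assume n: "e \<notin> R \<union> f ` R \<union> ?B"
      then have "insert e R \<in> ?F" using e RQ Rf by (auto simp: Q_def)
      from R(2)[OF this] n show False by auto
    qed
  qed
  then have "card Q \<le> card (R \<union> f ` R \<union> ?B)" using finR fin by (intro card_mono) auto
  also have "\<dots> \<le> card (R \<union> f ` R) + card ?B" by (rule card_Un_le)
  also have "card (R \<union> f ` R) \<le> card R + card (f ` R)" by (rule card_Un_le)
  also have "card (f ` R) \<le> card R" using finR by (rule card_image_le)
  also have "card ?B \<le> card R"
    by (rule card_inj_on_le[of f]) (use inj finR in \<open>auto intro: inj_on_subset\<close>)
  finally have 1: "card Q \<le> 3 * card R" by simp
  have "card {E. E \<subseteq> P \<and> f ` E = E} \<le> card (Pow (P - R))"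
  proof (rule card_inj_on_le)
    have *: "e \<in> E \<longleftrightarrow> (if e \<in> R then f e \<in> E - R else e \<in> E - R)" if E: "E \<subseteq> P" "f ` E = E" and "e \<in> P" for E e
    proof (cases "e \<in> R")
      case True
      have "e \<in> E" if "f e \<in> E"
      proof -
        have "f e \<in> f ` E" using that E(2) by simp
        then obtain e' where "e' \<in> E" "f e' = f e" by auto
        then show ?thesis using inj_onD[OF inj, of e' e] E(1) \<open>e \<in> P\<close> by auto
      qed
      moreover have "f e \<in> E" if "e \<in> E" using imageI[OF that, of f] unfolding E(2) .
      ultimately show ?thesis using True Rf[OF True] by auto
    qed simp
    show "inj_on (\<lambda>E. E - R) {E. E \<subseteq> P \<and> f ` E = E}"
    proof (rule inj_onI)
      fix E E' assume E: "E \<in> {E. E \<subseteq> P \<and> f ` E = E}" "E' \<in> {E. E \<subseteq> P \<and> f ` E = E}" and eq: "E - R = E' - R"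
      have "e \<in> E \<longleftrightarrow> e \<in> E'" if "e \<in> P" for e
        using *[of E e] *[of E' e] E that unfolding eq by simp
      then show "E = E'" using E by blast
    qed
  qed (use fin in auto)
  also have "\<dots> = 2 ^ (card P - card R)"
    using fin RP finR by (simp add: card_Pow card_Diff_subset)
  finally have 2: "card {E. E \<subseteq> P \<and> f ` E = E} \<le> 2 ^ (card P - card R)" .
  show thesis
    by (rule that[OF 1[unfolded Q_def] card_mono[OF fin RP] 2])
qed

definition pairs_of :: "'a set \<Rightarrow> 'a set set" where
  "pairs_of V = {{v, w} |v w. v \<in> V \<and> w \<in> V \<and> v \<noteq> w}"

lemma finite_pairs_of: "finite V \<Longrightarrow> finite (pairs_of V)"
  by (rule finite_subset[of _ "Pow V"]) (auto simp: pairs_of_def)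

lemma permutes_image_pairs_of:
  assumes "\<pi> permutes V" "E \<subseteq> pairs_of V"
  shows "(`) \<pi> ` E \<subseteq> pairs_of V"
proof
  fix e assume "e \<in> (`) \<pi> ` E"
  then obtain v w where vw: "v \<in> V" "w \<in> V" "v \<noteq> w" "e = {\<pi> v, \<pi> w}"
    using assms(2) unfolding pairs_of_def by blast
  then have "\<pi> v \<in> V" "\<pi> w \<in> V" "\<pi> v \<noteq> \<pi> w"
    using permutes_in_image[OF assms(1)] inj_eq[OF permutes_inj[OF assms(1)]] by simp_all
  then show "e \<in> pairs_of V" unfolding vw(4) pairs_of_def by blast
qed

text \<open>For a moved \<open>a\<close> and any \<open>b\<close> other than \<open>a\<close> and
  \<open>\<pi> a\<close>, the pair \<open>{a, b}\<close> is moved: its image contains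
  \<open>\<pi> a\<close>, the pair does not. Each pair arises from at most two choices of
  \<open>a\<close>, told apart by the bit \<open>a < b\<close>.\<close>

lemma card_moved_pairs:
  fixes V :: "nat set"
  assumes fin: "finite V" and \<pi>: "\<pi> permutes V"
  shows "card {x. \<pi> x \<noteq> x} * (card V - 2) \<le> 2 * card {e \<in> pairs_of V. \<pi> ` e \<noteq> e}"
proof -
  let ?M = "{x. \<pi> x \<noteq> x}" and ?Q = "{e \<in> pairs_of V. \<pi> ` e \<noteq> e}"
  have MV: "?M \<subseteq> V" using \<pi> by (auto simp: permutes_def)
  have finM: "finite ?M" using MV fin by (rule finite_subset)
  let ?D = "SIGMA a:?M. V - {a, \<pi> a}"
  have "card ?D = (\<Sum>a\<in>?M. card (V - {a, \<pi> a}))" using finM fin by (intro card_SigmaI) auto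
  also have "\<dots> = (\<Sum>a\<in>?M. card V - 2)"
  proof (rule sum.cong)
    fix a assume a: "a \<in> ?M"
    then have "{a, \<pi> a} \<subseteq> V" using MV permutes_in_image[OF \<pi>] by auto
    moreover have "card {a, \<pi> a} = 2" using a by auto
    ultimately show "card (V - {a, \<pi> a}) = card V - 2" by (simp add: card_Diff_subset)
  qed simp
  finally have "card ?D = card ?M * (card V - 2)" by simp
  moreover have "card ?D \<le> card (?Q \<times> (UNIV :: bool set))"
  proof (rule card_inj_on_le)
    show "inj_on (\<lambda>(a, b). ({a, b}, a < b)) ?D"
      by (rule inj_onI) (force simp: doubleton_eq_iff)
    show "(\<lambda>(a, b). ({a, b}, a < b)) ` ?D \<subseteq> ?Q \<times> UNIV"
    proof
      fix x assume "x \<in> (\<lambda>(a, b). ({a, b}, a < b)) ` ?D"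
      then obtain a b where ab: "\<pi> a \<noteq> a" "b \<in> V" "b \<noteq> a" "b \<noteq> \<pi> a" "x = ({a, b}, a < b)" by auto
      then have "{a, b} \<in> pairs_of V" using MV unfolding pairs_of_def by blast
      moreover have "{\<pi> a, \<pi> b} \<noteq> {a, b}" using ab(1,4) by (auto simp: doubleton_eq_iff)
      ultimately show "x \<in> ?Q \<times> UNIV" using ab(5) by simp
    qed
    show "finite (?Q \<times> (UNIV :: bool set))" using finite_pairs_of[OF fin] by simp
  qed
  moreover have "card (?Q \<times> (UNIV :: bool set)) = 2 * card ?Q"
    by (simp add: card_cartesian_product)
  ultimately show ?thesis by linarith
qed

lemma card_invariant_edge_sets:
  fixes V :: "nat set"
  assumes fin: "finite V" and \<pi>: "\<pi> permutes V"
  shows "real (card {E. E \<subseteq> pairs_of V \<and> (`) \<pi> ` E = E})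
    \<le> 2 ^ card (pairs_of V) * (2 powr (- real (card V - 2) / 6)) ^ card {x. \<pi> x \<noteq> x}"
proof -
  let ?P = "pairs_of V" and ?m = "card {x. \<pi> x \<noteq> x}"
  have PV: "?P \<subseteq> Pow V" by (auto simp: pairs_of_def)
  have "inj_on ((`) \<pi>) ?P"
    by (rule inj_on_subset[OF inj_on_image_Pow[OF permutes_inj_on[OF \<pi>]] PV])
  moreover have "(`) \<pi> ` ?P \<subseteq> ?P" by (rule permutes_image_pairs_of[OF \<pi>]) simp
  ultimately obtain k where k: "card {e \<in> ?P. \<pi> ` e \<noteq> e} \<le> 3 * k" "k \<le> card ?P"
    "card {E. E \<subseteq> ?P \<and> (`) \<pi> ` E = E} \<le> 2 ^ (card ?P - k)"
    using card_invariant_subsets[OF finite_pairs_of[OF fin], of "(`) \<pi>"] by blast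
  \<comment> \<open>The factor 2 for the two ends of a pair meets the factor 3 of the invariant
    subset count.\<close>
  have "?m * (card V - 2) \<le> 6 * k" using card_moved_pairs[OF fin \<pi>] k(1) by linarith
  then have "real (?m * (card V - 2)) \<le> real (6 * k)" by (rule of_nat_mono)
  then have km: "real ?m * real (card V - 2) \<le> 6 * real k" by simp
  have "real (card {E. E \<subseteq> ?P \<and> (`) \<pi> ` E = E}) \<le> 2 ^ (card ?P - k)"
    using of_nat_mono[OF k(3), where 'a = real] by simp
  also have "\<dots> = 2 ^ card ?P * 2 powr (- real k)"
    using k(2) by (simp add: power_diff powr_minus powr_realpow divide_inverse)
  also have "2 powr (- real k) \<le> 2 powr (real ?m * (- real (card V - 2) / 6))"
    using km by (intro powr_mono) auto
  also have "\<dots> = (2 powr (- real (card V - 2) / 6)) ^ ?m"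
    by (simp add: powr_powr mult.commute flip: powr_realpow)
  finally show ?thesis by simp
qed

text \<open>Choose the \<open>k\<close> moved points, then permute them in at most \<open>k!\<close>
  ways.\<close>

lemma card_permutations_moving:
  assumes "finite V"
  shows "card {\<pi>. \<pi> permutes V \<and> card {x. \<pi> x \<noteq> x} = k} \<le> card V ^ k"
proof -
  let ?I = "{M. M \<subseteq> V \<and> card M = k}"
  have fin: "finite ?I" using assms by simp
  have finM: "finite {\<pi>. \<pi> permutes M}" if "M \<in> ?I" for M
    using that assms by (auto intro: finite_permutations finite_subset)
  have "{\<pi>. \<pi> permutes V \<and> card {x. \<pi> x \<noteq> x} = k} \<subseteq> (\<Union>M\<in>?I. {\<pi>. \<pi> permutes M})"
  proof
    fix \<pi> assume "\<pi> \<in> {\<pi>. \<pi> permutes V \<and> card {x. \<pi> x \<noteq> x} = k}"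
    then have \<pi>: "\<pi> permutes V" "card {x. \<pi> x \<noteq> x} = k" by auto
    have "{x. \<pi> x \<noteq> x} \<subseteq> V" using \<pi>(1) by (auto simp: permutes_def)
    moreover have "\<pi> permutes {x. \<pi> x \<noteq> x}" using \<pi>(1) by (auto simp: permutes_def)
    ultimately show "\<pi> \<in> (\<Union>M\<in>?I. {\<pi>. \<pi> permutes M})" using \<pi>(2) by blast
  qed
  then have "card {\<pi>. \<pi> permutes V \<and> card {x. \<pi> x \<noteq> x} = k} \<le> card (\<Union>M\<in>?I. {\<pi>. \<pi> permutes M})"
    using fin finM by (intro card_mono) auto
  also have "\<dots> \<le> (\<Sum>M\<in>?I. card {\<pi>. \<pi> permutes M})" by (rule card_UN_le[OF fin])
  also have "\<dots> = (\<Sum>M\<in>?I. fact k)"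
    using assms by (intro sum.cong card_permutations) (auto intro: finite_subset)
  also have "\<dots> = (card V choose k) * fact k" using assms by (simp add: n_subsets)
  also have "\<dots> \<le> card V ^ k" by (rule binomial_fact_pow)
  finally show ?thesis .
qed

text \<open>Grouped by the number \<open>k\<close> of moved points, the permutations contribute at
  most \<open>(n * q) ^ k\<close> relative to all edge sets; as \<open>n * q\<close> is at most 1,
  each of the \<open>n\<close> groups is bounded by \<open>n * q\<close>.\<close>

lemma sum_invariant_edge_sets:
  fixes V :: "nat set"
  assumes fin: "finite V" and n: "n = card V" and q: "q = 2 powr (- real (n - 2) / 6)" and nq: "real n * q \<le> 1"
  shows "(\<Sum>\<pi> | \<pi> permutes V \<and> \<pi> \<noteq> id. real (card {E. E \<subseteq> pairs_of V \<and> (`) \<pi> ` E = E}))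
    \<le> 2 ^ card (pairs_of V) * (real n ^ 2 * q)"
proof -
  let ?S = "{\<pi>. \<pi> permutes V \<and> \<pi> \<noteq> id}" and ?N = "2 ^ card (pairs_of V) :: real"
  let ?m = "\<lambda>\<pi>. card {x. \<pi> x \<noteq> x}"
  have finS: "finite ?S" using finite_permutations[OF fin] by (auto intro: finite_subset)
  have q0: "q \<ge> 0" by (simp add: q)
  have m: "?m ` ?S \<subseteq> {1..n}"
  proof clarsimp
    fix \<pi> assume \<pi>: "\<pi> permutes V" "\<pi> \<noteq> id"
    have sub: "{x. \<pi> x \<noteq> x} \<subseteq> V" using \<pi>(1) by (auto simp: permutes_def)
    moreover have "{x. \<pi> x \<noteq> x} \<noteq> {}" using \<pi>(2) by (auto simp: fun_eq_iff)
    ultimately show "Suc 0 \<le> ?m \<pi> \<and> ?m \<pi> \<le> n"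
      using fin card_mono[OF fin sub] by (auto simp: n Suc_le_eq card_gt_0_iff intro: finite_subset)
  qed
  have "(\<Sum>\<pi>\<in>?S. real (card {E. E \<subseteq> pairs_of V \<and> (`) \<pi> ` E = E})) \<le> (\<Sum>\<pi>\<in>?S. ?N * q ^ ?m \<pi>)"
    using card_invariant_edge_sets[OF fin] by (intro sum_mono) (auto simp: q n)
  also have "\<dots> = ?N * (\<Sum>\<pi>\<in>?S. q ^ ?m \<pi>)" by (simp add: sum_distrib_left)
  finally have le: "(\<Sum>\<pi>\<in>?S. real (card {E. E \<subseteq> pairs_of V \<and> (`) \<pi> ` E = E}))
      \<le> ?N * (\<Sum>\<pi>\<in>?S. q ^ ?m \<pi>)" .
  have "(\<Sum>\<pi>\<in>?S. q ^ ?m \<pi>) = (\<Sum>k\<in>{1..n}. \<Sum>\<pi> | \<pi> \<in> ?S \<and> ?m \<pi> = k. q ^ ?m \<pi>)"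
    by (rule sum.group[OF finS _ m, symmetric]) simp
  also have "\<dots> \<le> (\<Sum>k\<in>{1..n}. real n * q)"
  proof (rule sum_mono)
    fix k assume k: "k \<in> {1..n}"
    have "(\<Sum>\<pi> | \<pi> \<in> ?S \<and> ?m \<pi> = k. q ^ ?m \<pi>) = real (card {\<pi>. \<pi> \<in> ?S \<and> ?m \<pi> = k}) * q ^ k"
      by simp
    also have "card {\<pi>. \<pi> \<in> ?S \<and> ?m \<pi> = k} \<le> card {\<pi>. \<pi> permutes V \<and> ?m \<pi> = k}"
      by (rule card_mono) (use finite_permutations[OF fin] in \<open>auto intro: finite_subset\<close>)
    then have "real (card {\<pi>. \<pi> \<in> ?S \<and> ?m \<pi> = k}) * q ^ k \<le> real (n ^ k) * q ^ k"
      using card_permutations_moving[OF fin, of k] q0 n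
      by (intro mult_right_mono) (auto simp del: of_nat_power)
    also have "\<dots> = (real n * q) ^ k" by (simp add: power_mult_distrib)
    also have "\<dots> \<le> (real n * q) ^ 1" using k nq q0 by (intro power_decreasing) auto
    finally show "(\<Sum>\<pi> | \<pi> \<in> ?S \<and> ?m \<pi> = k. q ^ ?m \<pi>) \<le> real n * q" by simp
  qed
  also have "\<dots> = real n ^ 2 * q" by (simp add: power2_eq_square)
  finally have "?N * (\<Sum>\<pi>\<in>?S. q ^ ?m \<pi>) \<le> ?N * (real n ^ 2 * q)" by (rule mult_left_mono) simp
  with le show ?thesis by (rule order_trans)
qed

text \<open>Each \<open>z\<close> leaves three of the four membership patterns of \<open>f z\<close>
  and \<open>g z\<close>, and the choices for different \<open>z\<close> are independent because all
  these elements are distinct.\<close>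

lemma card_subsets_avoiding_pattern:
  assumes fin: "finite P" "finite Z" and f: "inj_on f Z" "f ` Z \<subseteq> P" and g: "inj_on g Z" "g ` Z \<subseteq> P"
    and disj: "f ` Z \<inter> g ` Z = {}"
  shows "real (card {E. E \<subseteq> P \<and> (\<forall>z\<in>Z. f z \<in> E \<or> g z \<notin> E)}) \<le> 2 ^ card P * (3 / 4) ^ card Z"
proof -
  let ?L = "{E. E \<subseteq> P \<and> (\<forall>z\<in>Z. f z \<in> E \<or> g z \<notin> E)}"
  let ?U = "f ` Z \<union> g ` Z" and ?T = "{(True, True), (True, False), (False, False)}"
  have U: "?U \<subseteq> P" "finite ?U" "card ?U = 2 * card Z"
    using f g disj fin by (auto simp: card_Un_disjoint card_image)
  have "card ?L \<le> card (Pow (P - ?U) \<times> (Z \<rightarrow>\<^sub>E ?T))"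
  proof (rule card_inj_on_le)
    let ?h = "\<lambda>E. (E - ?U, \<lambda>z\<in>Z. (f z \<in> E, g z \<in> E))"
    show "inj_on ?h ?L"
    proof (rule inj_onI)
      fix E E' assume "?h E = ?h E'"
      then have d: "E - ?U = E' - ?U" and "\<And>z. z \<in> Z \<Longrightarrow> (\<lambda>z\<in>Z. (f z \<in> E, g z \<in> E)) z = (\<lambda>z\<in>Z. (f z \<in> E', g z \<in> E')) z"
        by (auto dest: fun_cong)
      then have "f z \<in> E \<longleftrightarrow> f z \<in> E'" "g z \<in> E \<longleftrightarrow> g z \<in> E'" if "z \<in> Z" for z
        using that by auto
      then show "E = E'" using d by blast
    qed
    show "?h ` ?L \<subseteq> Pow (P - ?U) \<times> (Z \<rightarrow>\<^sub>E ?T)" by (auto simp: PiE_iff)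
    show "finite (Pow (P - ?U) \<times> (Z \<rightarrow>\<^sub>E ?T))" using fin by (intro finite_cartesian_product finite_PiE) auto
  qed
  also have "\<dots> = 2 ^ (card P - 2 * card Z) * 3 ^ card Z"
    using U fin by (simp add: card_cartesian_product card_Pow card_Diff_subset card_PiE numeral_3_eq_3)
  finally have "real (card ?L) \<le> real (2 ^ (card P - 2 * card Z) * 3 ^ card Z)" by (rule of_nat_mono)
  also have "2 * card Z \<le> card P" using card_mono[OF fin(1) U(1)] U(3) by simp
  then have "real (2 ^ (card P - 2 * card Z) * 3 ^ card Z) = 2 ^ card P * (3 / 4) ^ card Z"
  proof -
    have "real (2 ^ (card P - 2 * card Z) * 3 ^ card Z) = (2::real) ^ (card P - 2 * card Z) * 3 ^ card Z" by simp
    also have "(2::real) ^ (card P - 2 * card Z) = 2 ^ card P / 4 ^ card Z"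
      using \<open>2 * card Z \<le> card P\<close> by (subst power_diff) (simp_all add: power_mult)
    finally show ?thesis by (simp add: power_divide)
  qed
  finally show ?thesis .
qed

text \<open>A union bound over ordered pairs \<open>(u, w)\<close>: each \<open>z\<close> outside
  the pair must avoid the pattern of being adjacent to \<open>w\<close> but not to
  \<open>u\<close>.\<close>

lemma card_dominated:
  assumes fin: "finite V" and n: "n = card V"
  shows "real (card {E. E \<subseteq> pairs_of V \<and> \<not> undominated V E}) \<le> 2 ^ card (pairs_of V) * (real n ^ 2 * (3 / 4) ^ (n - 2))"
proof -
  let ?I = "{(u, w). u \<in> V \<and> w \<in> V \<and> u \<noteq> w}"
  let ?L = "\<lambda>(u, w). {E. E \<subseteq> pairs_of V \<and> (\<forall>z\<in>V - {u, w}. {z, u} \<in> E \<or> {z, w} \<notin> E)}"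
  have I: "?I \<subseteq> V \<times> V" by auto
  have finI: "finite ?I" by (rule finite_subset[OF I]) (use fin in simp)
  have "card ?I \<le> n * n" using card_mono[OF _ I] fin by (simp add: n card_cartesian_product)
  then have "real (card ?I) \<le> real (n * n)" by (rule of_nat_mono)
  then have cI: "real (card ?I) \<le> real n ^ 2" by (simp add: power2_eq_square)
  have finL: "finite (?L i)" for i
    by (rule finite_subset[of _ "Pow (pairs_of V)"]) (use finite_pairs_of[OF fin] in auto)
  have "{E. E \<subseteq> pairs_of V \<and> \<not> undominated V E} \<subseteq> (\<Union>i\<in>?I. ?L i)"
    unfolding undominated_def by blast
  then have "card {E. E \<subseteq> pairs_of V \<and> \<not> undominated V E} \<le> card (\<Union>i\<in>?I. ?L i)"
    using finI finL by (intro card_mono) auto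
  also have "\<dots> \<le> (\<Sum>i\<in>?I. card (?L i))" by (rule card_UN_le[OF finI])
  finally have "real (card {E. E \<subseteq> pairs_of V \<and> \<not> undominated V E}) \<le> (\<Sum>i\<in>?I. real (card (?L i)))"
    using of_nat_mono[where 'a = real] by (fastforce simp flip: of_nat_sum)
  also have "\<dots> \<le> (\<Sum>i\<in>?I. 2 ^ card (pairs_of V) * (3 / 4) ^ (n - 2))"
  proof (rule sum_mono)
    fix i assume "i \<in> ?I"
    then obtain u w where i: "i = (u, w)" and uw: "u \<in> V" "w \<in> V" "u \<noteq> w" by auto
    let ?Z = "V - {u, w}"
    have cZ: "card ?Z = n - 2" using uw by (simp add: n card_Diff_subset)
    have "real (card {E. E \<subseteq> pairs_of V \<and> (\<forall>z\<in>?Z. {z, u} \<in> E \<or> {z, w} \<notin> E)})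
        \<le> 2 ^ card (pairs_of V) * (3 / 4) ^ card ?Z"
      using fin finite_pairs_of[OF fin] uw
      by (intro card_subsets_avoiding_pattern) (auto simp: inj_on_def pairs_of_def doubleton_eq_iff)
    then show "real (card (?L i)) \<le> 2 ^ card (pairs_of V) * (3 / 4) ^ (n - 2)" by (simp add: i cZ)
  qed
  also have "\<dots> = real (card ?I) * (2 ^ card (pairs_of V) * (3 / 4) ^ (n - 2))" by simp
  also have "\<dots> \<le> real n ^ 2 * (2 ^ card (pairs_of V) * (3 / 4) ^ (n - 2))"
    by (rule mult_right_mono[OF cI]) simp
  finally show ?thesis by (simp add: mult_ac)
qed

section \<open>Unlabelled graphs\<close>

text \<open>The vertex set is left alone because only its own permutations are applied.\<close>

definition permute_graph :: "('a \<Rightarrow> 'a) \<Rightarrow> 'a graph \<Rightarrow> 'a graph" where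
  "permute_graph \<pi> \<Gamma> = (fst \<Gamma>, (`) \<pi> ` snd \<Gamma>)"

lemma graphs_on_eq: "graphs_on n = Pair {..<n} ` Pow (pairs_of {..<n})"
  by (auto simp: graphs_on_def is_graph_def pairs_of_def image_iff)

lemma image_edges_cong:
  assumes "E \<subseteq> pairs_of V" "\<And>v. v \<in> V \<Longrightarrow> f v = h v"
  shows "(`) f ` E = (`) h ` E"
proof (rule image_cong)
  fix e assume "e \<in> E"
  then have "e \<subseteq> V" using assms(1) by (auto simp: pairs_of_def)
  then show "f ` e = h ` e" using assms(2) by (intro image_cong) auto
qed simp

lemma permutes_extension:
  assumes "bij_betw f V V"
  shows "(\<lambda>x. if x \<in> V then f x else x) permutes V"
  by (rule bij_imp_permutes) (use assms in \<open>auto cong: bij_betw_cong\<close>)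

text \<open>An isomorphism matters on the vertices only; extending it by the identity turns it into
  a permutation in the sense of \<open>permutes\<close>.\<close>

lemma isomorphic_iff_permute_graph:
  assumes "\<Gamma> \<in> graphs_on n" "\<Delta> \<in> graphs_on n"
  shows "graph_isomorphic \<Gamma> \<Delta> \<longleftrightarrow> (\<exists>\<pi>. \<pi> permutes {..<n} \<and> \<Delta> = permute_graph \<pi> \<Gamma>)"
proof -
  obtain E F where \<Gamma>: "\<Gamma> = ({..<n}, E)" "E \<subseteq> pairs_of {..<n}" and \<Delta>: "\<Delta> = ({..<n}, F)"
    using assms by (auto simp: graphs_on_eq)
  show ?thesis
  proof
    assume "graph_isomorphic \<Gamma> \<Delta>"
    then obtain f where f: "bij_betw f {..<n} {..<n}" "(`) f ` E = F"
      by (auto simp: graph_isomorphic_def \<Gamma> \<Delta>)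
    define \<pi> where "\<pi> = (\<lambda>x. if x \<in> {..<n} then f x else x)"
    have "(`) \<pi> ` E = F"
      using image_edges_cong[OF \<Gamma>(2), of \<pi> f] f(2) by (simp add: \<pi>_def)
    then have "\<Delta> = permute_graph \<pi> \<Gamma>" by (simp add: \<Gamma>(1) \<Delta> permute_graph_def)
    then show "\<exists>\<pi>. \<pi> permutes {..<n} \<and> \<Delta> = permute_graph \<pi> \<Gamma>"
      using permutes_extension[OF f(1)] unfolding \<pi>_def by blast
  next
    assume "\<exists>\<pi>. \<pi> permutes {..<n} \<and> \<Delta> = permute_graph \<pi> \<Gamma>"
    then show "graph_isomorphic \<Gamma> \<Delta>"
      by (auto simp: graph_isomorphic_def \<Gamma> \<Delta> permute_graph_def dest: permutes_imp_bij)
  qed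
qed

definition graph_iso_rel :: "nat \<Rightarrow> (nat graph \<times> nat graph) set" where
  "graph_iso_rel n = {(\<Gamma>, \<Delta>). \<Gamma> \<in> graphs_on n \<and> \<Delta> \<in> graphs_on n \<and> graph_isomorphic \<Gamma> \<Delta>}"

lemma permutation_action_graphs:
  "permutation_action {..<n} (graphs_on n) permute_graph (graph_iso_rel n)"
proof
  show "finite (graphs_on n)"
    unfolding graphs_on_eq by (intro finite_imageI finite_Pow_iff[THEN iffD2] finite_pairs_of) simp
  show "permute_graph \<pi> \<Gamma> \<in> graphs_on n" if \<pi>: "\<pi> permutes {..<n}" and \<Gamma>: "\<Gamma> \<in> graphs_on n" for \<pi> \<Gamma>
  proof -
    obtain E where E: "\<Gamma> = ({..<n}, E)" "E \<subseteq> pairs_of {..<n}" using \<Gamma> by (auto simp: graphs_on_eq)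
    show ?thesis
      unfolding graphs_on_eq E(1) permute_graph_def
      using permutes_image_pairs_of[OF \<pi> E(2)] by (intro image_eqI[OF _ PowI]) simp_all
  qed
  show "permute_graph id \<Gamma> = \<Gamma>" for \<Gamma> :: "nat graph"
    by (simp add: permute_graph_def)
  show "permute_graph (\<pi> \<circ> \<tau>) \<Gamma> = permute_graph \<pi> (permute_graph \<tau> \<Gamma>)" for \<pi> \<tau> and \<Gamma> :: "nat graph"
    by (simp add: permute_graph_def image_image image_comp)
  show "graph_iso_rel n = {(x, y). x \<in> graphs_on n \<and> y \<in> graphs_on n \<and>
      (\<exists>\<pi>. \<pi> permutes {..<n} \<and> y = permute_graph \<pi> x)}"
    unfolding graph_iso_rel_def
    by (intro Collect_cong) (simp add: isomorphic_iff_permute_graph split: prod.split cong: conj_cong)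
qed simp

lemma card_fixed_graphs:
  "card {\<Gamma> \<in> graphs_on n. permute_graph \<pi> \<Gamma> = \<Gamma>} = card {E. E \<subseteq> pairs_of {..<n} \<and> (`) \<pi> ` E = E}"
proof -
  have "{\<Gamma> \<in> graphs_on n. permute_graph \<pi> \<Gamma> = \<Gamma>} = Pair {..<n} ` {E. E \<subseteq> pairs_of {..<n} \<and> (`) \<pi> ` E = E}"
  proof (intro equalityI subsetI)
    fix \<Gamma> assume "\<Gamma> \<in> {\<Gamma> \<in> graphs_on n. permute_graph \<pi> \<Gamma> = \<Gamma>}"
    then obtain E where "\<Gamma> = ({..<n}, E)" "E \<subseteq> pairs_of {..<n}" "permute_graph \<pi> \<Gamma> = \<Gamma>"
      by (auto simp: graphs_on_eq)
    then show "\<Gamma> \<in> Pair {..<n} ` {E. E \<subseteq> pairs_of {..<n} \<and> (`) \<pi> ` E = E}"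
      by (simp add: permute_graph_def)
  next
    fix \<Gamma> assume "\<Gamma> \<in> Pair {..<n} ` {E. E \<subseteq> pairs_of {..<n} \<and> (`) \<pi> ` E = E}"
    then obtain E where "\<Gamma> = ({..<n}, E)" "E \<subseteq> pairs_of {..<n}" "(`) \<pi> ` E = E" by blast
    then show "\<Gamma> \<in> {\<Gamma> \<in> graphs_on n. permute_graph \<pi> \<Gamma> = \<Gamma>}"
      by (simp add: graphs_on_eq permute_graph_def)
  qed
  then show ?thesis by (simp add: card_image inj_on_def)
qed

lemma not_asymmetric_imp_invariant:
  assumes "E \<subseteq> pairs_of V" "\<not> asymmetric_graph V E"
  obtains \<pi> where "\<pi> permutes V" "\<pi> \<noteq> id" "(`) \<pi> ` E = E"
proof -
  obtain \<sigma> v where \<sigma>: "bij_betw \<sigma> V V" "(`) \<sigma> ` E = E" "v \<in> V" "\<sigma> v \<noteq> v"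
    using assms(2) by (auto simp: asymmetric_graph_def)
  let ?\<pi> = "\<lambda>x. if x \<in> V then \<sigma> x else x"
  show thesis
  proof (rule that[of ?\<pi>])
    show "?\<pi> permutes V" by (rule permutes_extension[OF \<sigma>(1)])
    show "?\<pi> \<noteq> id" using \<sigma>(3,4) by (auto simp: fun_eq_iff)
    show "(`) ?\<pi> ` E = E" using image_edges_cong[OF assms(1), of ?\<pi> \<sigma>] \<sigma>(2) by simp
  qed
qed

section \<open>Good graphs and the limit of the proportions\<close>

definition good_graphs :: "nat \<Rightarrow> nat graph set" where
  "good_graphs n = {\<Gamma> \<in> graphs_on n. undominated {..<n} (snd \<Gamma>) \<and> asymmetric_graph {..<n} (snd \<Gamma>)}"

lemma good_graph_index:
  assumes "\<Gamma> \<in> good_graphs n" "n \<ge> 2"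
  shows "R_infinity_nilpotency_index (raag \<Gamma>) = 2"
proof -
  obtain E where E: "\<Gamma> = ({..<n}, E)" "is_graph ({..<n}, E)" "undominated {..<n} E" "asymmetric_graph {..<n} E"
    using assms(1) by (auto simp: good_graphs_def graphs_on_def) (metis prod.collapse)
  have "(0::nat) \<in> {..<n}" "(1::nat) \<in> {..<n}" using assms(2) by auto
  \<comment> \<open>The witness for the pair 0, 1 comes with an edge to 1.\<close>
  then have "E \<noteq> {}" using E(3) unfolding undominated_def by (metis empty_iff zero_neq_one)
  then show ?thesis unfolding E(1) using E(2-4) by (intro raag_index_eq_2)
qed

lemma card_good_graphs:
  assumes q: "q = 2 powr (- real (n - 2) / 6)" and nq: "real n * q \<le> 1"
  shows "2 ^ card (pairs_of {..<n}) * (1 - real n ^ 2 * q - real n ^ 2 * (3 / 4) ^ (n - 2)) \<le> real (card (good_graphs n))"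
proof -
  let ?P = "pairs_of {..<n}" and ?S = "{\<pi>. \<pi> permutes {..<n} \<and> \<pi> \<noteq> id}"
  let ?D = "{E. E \<subseteq> ?P \<and> \<not> undominated {..<n} E}"
  let ?I = "\<lambda>\<pi>. {E. E \<subseteq> ?P \<and> (`) \<pi> ` E = E}"
  let ?Y = "{E. E \<subseteq> ?P \<and> undominated {..<n} E \<and> asymmetric_graph {..<n} E}"
  have finP: "finite ?P" by (simp add: finite_pairs_of)
  have finS: "finite ?S" using finite_permutations[of "{..<n}"] by (auto intro: finite_subset)
  have fin: "finite {E. E \<subseteq> ?P \<and> Q E}" for Q
    by (rule finite_subset[of _ "Pow ?P"]) (use finP in auto)
  have "Pow ?P \<subseteq> ?Y \<union> ?D \<union> (\<Union>\<pi>\<in>?S. ?I \<pi>)"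
  proof
    fix E assume E: "E \<in> Pow ?P"
    show "E \<in> ?Y \<union> ?D \<union> (\<Union>\<pi>\<in>?S. ?I \<pi>)"
    proof (cases "asymmetric_graph {..<n} E")
      case False
      then obtain \<pi> where "\<pi> permutes {..<n}" "\<pi> \<noteq> id" "(`) \<pi> ` E = E"
        using not_asymmetric_imp_invariant E by blast
      then show ?thesis using E by blast
    qed (use E in auto)
  qed
  then have "card (Pow ?P) \<le> card (?Y \<union> ?D \<union> (\<Union>\<pi>\<in>?S. ?I \<pi>))"
    using fin finS by (intro card_mono) auto
  also have "\<dots> \<le> card (?Y \<union> ?D) + card (\<Union>\<pi>\<in>?S. ?I \<pi>)" by (rule card_Un_le)
  also have "\<dots> \<le> card ?Y + card ?D + (\<Sum>\<pi>\<in>?S. card (?I \<pi>))"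
    by (intro add_mono card_Un_le card_UN_le finS)
  finally have "real (2 ^ card ?P) \<le> real (card ?Y + card ?D + (\<Sum>\<pi>\<in>?S. card (?I \<pi>)))"
    using finP by (intro of_nat_mono) (simp add: card_Pow)
  then have "2 ^ card ?P \<le> real (card ?Y) + real (card ?D) + (\<Sum>\<pi>\<in>?S. real (card (?I \<pi>)))"
    by simp
  moreover have "real (card ?D) \<le> 2 ^ card ?P * (real n ^ 2 * (3 / 4) ^ (n - 2))"
    by (rule card_dominated) auto
  moreover have "(\<Sum>\<pi>\<in>?S. real (card (?I \<pi>))) \<le> 2 ^ card ?P * (real n ^ 2 * q)"
    by (rule sum_invariant_edge_sets[OF _ _ q nq]) auto
  moreover have "good_graphs n = Pair {..<n} ` ?Y"
  proof (intro equalityI subsetI)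
    fix \<Gamma> assume "\<Gamma> \<in> good_graphs n"
    then obtain E where "\<Gamma> = ({..<n}, E)" "E \<in> ?Y" by (auto simp: good_graphs_def graphs_on_eq)
    then show "\<Gamma> \<in> Pair {..<n} ` ?Y" by blast
  next
    fix \<Gamma> assume "\<Gamma> \<in> Pair {..<n} ` ?Y"
    then obtain E where "\<Gamma> = ({..<n}, E)" "E \<in> ?Y" by blast
    then show "\<Gamma> \<in> good_graphs n" by (simp add: good_graphs_def graphs_on_eq)
  qed
  then have "card (good_graphs n) = card ?Y" by (simp add: card_image inj_on_def)
  ultimately show ?thesis by (simp add: algebra_simps)
qed

text \<open>In the half of Burnside's lemma the identity fixes every graph and gives the leading
  term; all other permutations together form the error term.\<close>

lemma card_unlabelled_graphs_le:
  assumes q: "q = 2 powr (- real (n - 2) / 6)" and nq: "real n * q \<le> 1"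
  shows "real (card (unlabelled_graphs n)) * fact n \<le> 2 ^ card (pairs_of {..<n}) * (1 + real n ^ 2 * q)"
proof -
  interpret permutation_action "{..<n}" "graphs_on n" permute_graph "graph_iso_rel n"
    by (rule permutation_action_graphs)
  let ?P = "pairs_of {..<n}" and ?I = "\<lambda>\<pi>. {E. E \<subseteq> pairs_of {..<n} \<and> (`) \<pi> ` E = E}"
  have finS: "finite {\<pi>. \<pi> permutes {..<n} \<and> \<pi> \<noteq> id}"
    using finite_permutations[of "{..<n}"] by (auto intro: finite_subset)
  have S: "{\<pi>. \<pi> permutes {..<n}} = insert id {\<pi>. \<pi> permutes {..<n} \<and> \<pi> \<noteq> id}"
    using permutes_id by auto
  have "card (unlabelled_graphs n) * fact n \<le> (\<Sum>\<pi> | \<pi> permutes {..<n}. card (?I \<pi>))"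
    using orbits_le_sum_fixed_points
    by (simp add: unlabelled_graphs_def graph_iso_rel_def[symmetric] card_permutations card_fixed_graphs)
  also have "\<dots> = card (?I id) + (\<Sum>\<pi> | \<pi> permutes {..<n} \<and> \<pi> \<noteq> id. card (?I \<pi>))"
    unfolding S by (rule sum.insert[OF finS]) simp
  also have "card (?I id) = 2 ^ card ?P"
    using card_Pow[of ?P] finite_pairs_of[of "{..<n}"] by (simp add: Pow_def)
  finally have "real (card (unlabelled_graphs n) * fact n)
      \<le> real (2 ^ card ?P + (\<Sum>\<pi> | \<pi> permutes {..<n} \<and> \<pi> \<noteq> id. card (?I \<pi>)))"
    by (rule of_nat_mono)
  then have "real (card (unlabelled_graphs n)) * fact n
      \<le> 2 ^ card ?P + (\<Sum>\<pi> | \<pi> permutes {..<n} \<and> \<pi> \<noteq> id. real (card (?I \<pi>)))"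
    by simp
  moreover have "(\<Sum>\<pi> | \<pi> permutes {..<n} \<and> \<pi> \<noteq> id. real (card (?I \<pi>))) \<le> 2 ^ card ?P * (real n ^ 2 * q)"
    by (rule sum_invariant_edge_sets[OF _ _ q nq]) auto
  ultimately show ?thesis by (simp add: algebra_simps)
qed

lemma finite_unlabelled_graphs: "finite (unlabelled_graphs n)"
proof -
  interpret permutation_action "{..<n}" "graphs_on n" permute_graph "graph_iso_rel n"
    by (rule permutation_action_graphs)
  show ?thesis
    unfolding unlabelled_graphs_def graph_iso_rel_def[symmetric]
    using finite_X equiv_r by (intro finite_quotient) (auto simp: equiv_def)
qed

lemma card_unlabelled_graphs_pos: "card (unlabelled_graphs n) > 0"
proof -
  have "({..<n}, {}) \<in> graphs_on n" by (auto simp: graphs_on_eq)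
  then have "unlabelled_graphs n \<noteq> {}" unfolding unlabelled_graphs_def quotient_def by blast
  then show ?thesis using finite_unlabelled_graphs by (simp add: card_gt_0_iff)
qed

text \<open>Multiplying both class counts by \<open>fact n\<close> compares each with the number of
  labelled graphs, so \<open>fact n\<close> and \<open>N\<close> cancel in the quotient.\<close>

lemma proportion_index_2_ge:
  assumes "n \<ge> 2" and q: "q = 2 powr (- real (n - 2) / 6)" and nq: "real n * q \<le> 1"
  shows "(1 - real n ^ 2 * q - real n ^ 2 * (3 / 4) ^ (n - 2)) / (1 + real n ^ 2 * q)
    \<le> real (card {C \<in> unlabelled_graphs n. \<exists>\<Gamma>\<in>C. R_infinity_nilpotency_index (raag \<Gamma>) = 2})
        / real (card (unlabelled_graphs n))"
proof -
  interpret permutation_action "{..<n}" "graphs_on n" permute_graph "graph_iso_rel n"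
    by (rule permutation_action_graphs)
  let ?D = "{C \<in> unlabelled_graphs n. \<exists>\<Gamma>\<in>C. R_infinity_nilpotency_index (raag \<Gamma>) = 2}"
  let ?G = "{C \<in> graphs_on n // graph_iso_rel n. \<exists>\<Gamma>\<in>C. \<Gamma> \<in> good_graphs n}"
  define a b c where "a = 1 - real n ^ 2 * q - real n ^ 2 * (3 / 4) ^ (n - 2)"
    and "b = 1 + real n ^ 2 * q" and "c = real (card (unlabelled_graphs n))"
  define N :: real where "N = 2 ^ card (pairs_of {..<n})"
  have N: "N > 0" by (simp add: N_def)
  have b: "b > 0" using q by (simp add: b_def add_pos_nonneg)
  have c: "c > 0" using card_unlabelled_graphs_pos by (simp add: c_def)
  have "card (good_graphs n) \<le> card ?G * fact n"
    using card_le_orbits_meeting[of "good_graphs n"] by (simp add: good_graphs_def card_permutations)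
  also have "card ?G \<le> card ?D"
    using finite_unlabelled_graphs good_graph_index[OF _ assms(1)]
    by (intro card_mono) (auto simp: unlabelled_graphs_def graph_iso_rel_def)
  finally have "real (card (good_graphs n)) \<le> real (card ?D * fact n)" by (intro of_nat_mono) simp
  then have 1: "N * a \<le> real (card ?D) * fact n"
    using card_good_graphs[OF q nq] by (simp add: N_def a_def)
  have 2: "c * fact n \<le> N * b"
    using card_unlabelled_graphs_le[OF q nq] by (simp add: N_def b_def c_def)
  have "a * c \<le> real (card ?D) * b"
  \<comment> \<open>Multiplying the two estimates needs \<open>a\<close> nonnegative; for negative
    \<open>a\<close> the bound is trivial.\<close>
  proof (cases "a \<ge> 0")
    case True
    have "(N * fact n) * (a * c) = (N * a) * (c * fact n)" by (simp add: mult_ac)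
    also have "\<dots> \<le> (real (card ?D) * fact n) * (N * b)"
      using True N c by (intro mult_mono 1 2) auto
    also have "\<dots> = (N * fact n) * (real (card ?D) * b)" by (simp add: mult_ac)
    finally show ?thesis using N by (simp add: mult_le_cancel_left_pos)
  next
    case False
    then have "a * c \<le> 0" using c by (simp add: mult_le_0_iff)
    also have "0 \<le> real (card ?D) * b" using b by simp
    finally show ?thesis .
  qed
  then have "a / b \<le> real (card ?D) / c" using b c by (simp add: divide_simps mult_ac)
  then show ?thesis by (simp add: a_def b_def c_def)
qed

theorem corollary1p5:
  shows "(\<lambda>n. real (card {C \<in> unlabelled_graphs n.
                  \<exists>\<Gamma>\<in>C. R_infinity_nilpotency_index (raag \<Gamma>) = 2})
            / real (card (unlabelled_graphs n))) \<longlonglongrightarrow> 1"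
proof (rule tendsto_sandwich)
  \<comment> \<open>Subtraction is taken in the reals to suit asymptotic reasoning; it agrees with
    the truncated one for \<open>n \<ge> 2\<close>. The factor 16/9 below is the inverse square of
    3/4, from the exponent \<open>n - 2\<close>.\<close>
  let ?q = "\<lambda>n. 2 powr (- (real n - 2) / 6)"
  show "\<forall>\<^sub>F n in sequentially.
      (1 - real n ^ 2 * ?q n - real n ^ 2 * ((3 / 4) ^ n * (16 / 9))) / (1 + real n ^ 2 * ?q n)
      \<le> real (card {C \<in> unlabelled_graphs n. \<exists>\<Gamma>\<in>C. R_infinity_nilpotency_index (raag \<Gamma>) = 2})
          / real (card (unlabelled_graphs n))"
  proof -
    have "(\<lambda>n. real n * ?q n) \<longlonglongrightarrow> 0" by real_asymp
    then have "\<forall>\<^sub>F n in sequentially. real n * ?q n < 1" by (rule order_tendstoD) simp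
    then show ?thesis
      using eventually_ge_at_top[of 2]
    proof eventually_elim
      case (elim n)
      have "(3 / 4 :: real) ^ (n - 2) = (3 / 4) ^ n * (16 / 9)"
        using elim(2) by (subst power_diff) (auto simp: power2_eq_square)
      moreover have "?q n = 2 powr (- real (n - 2) / 6)" using elim(2) by (simp add: of_nat_diff)
      note proportion_index_2_ge[OF elim(2) this less_imp_le[OF elim(1)]]
      ultimately show ?case by (simp only:)
    qed
  qed
  show "\<forall>\<^sub>F n in sequentially.
      real (card {C \<in> unlabelled_graphs n. \<exists>\<Gamma>\<in>C. R_infinity_nilpotency_index (raag \<Gamma>) = 2})
          / real (card (unlabelled_graphs n)) \<le> 1"
    using card_mono[OF finite_unlabelled_graphs] card_unlabelled_graphs_pos
    by (intro always_eventually allI) (simp add: divide_le_eq_1)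
  show "(\<lambda>n. (1 - real n ^ 2 * ?q n - real n ^ 2 * ((3 / 4) ^ n * (16 / 9))) / (1 + real n ^ 2 * ?q n))
      \<longlonglongrightarrow> 1"
  proof -
    have q: "(\<lambda>n. real n ^ 2 * ?q n) \<longlonglongrightarrow> 0" by real_asymp
    have d: "(\<lambda>n. real n ^ 2 * ((3 / 4) ^ n * (16 / 9))) \<longlonglongrightarrow> 0" by real_asymp
    show ?thesis
      using tendsto_divide[OF tendsto_diff[OF tendsto_diff[OF tendsto_const[of 1] q] d]
          tendsto_add[OF tendsto_const[of 1] q]] by simp
  qed
qed simp

end
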